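(* Let $f$ be a weakly holomorphic modular function for $\mathrm{SL}(2,\mathbb{Z})$ that is real and non-negative on the geodesic arc $\{e^{it}:\pi/3\le t\le 2\pi/3\}$, and assume that $t\mapsto f(e^{it})$ is increasing for $t\in[\pi/3,\pi/2]$. Then for every real quadratic irrationality $w$ we have $\mathrm{Re}(\mathrm{val}_f(w))\geq \mathrm{val}_f(\phi)$, where $\phi=\frac{1+\sqrt5}{2}$.
   Context: A weakly holomorphic modular function for $\mathrm{SL}(2,\mathbb{Z})$ is a holomorphic $\mathrm{SL}(2,\mathbb{Z})$-invariant function on the upper half-plane $\mathbb{H}$ whose $q$-expansion ($q=e^{2\pi i\tau}$) has only finitely many negative powers of $q$. For hyperbolic $A\in\mathrm{SL}(2,\mathbb{Z})$ with attracting fixed point $\tilde w$ and repelling fixed point $w$, let $Q(x,y)=ax^2+bxy+cy^2$ be the integral primitive indefinite quadratic form with $Q(w,1)=Q(\tilde w,1)=0$ and $\mathrm{sgn}(a)=\mathrm{sgn}(w-\tilde w)$, and $D=b^2-4ac$. Define $I_f(A)=\int_{\tau_0}^{A\tau_0}\frac{f(\tau)\sqrt D}{Q(\tau,1)}d\tau$ (any $\tau_0\in\mathbb{H}$); $I_1(A)=2\log\varepsilon$ with $\varepsilon>1$ the largest eigenvalue of $A$. For a real quadratic irrationality $w$ define $\mathrm{val}_f(w)=I_f(A)/I_1(A)$ for any hyperbolic $A\in\mathrm{SL}(2,\mathbb{Z})$ fixing $w$ (independent of $A$). The value $\mathrm{val}_f(\phi)$ is real. *)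

theory Defs
  imports "HOL-Complex_Analysis.Complex_Analysis"
begin

definition upper_half_plane :: "complex set" where
  "upper_half_plane = {\<tau>. Im \<tau> > 0}"

definition SL2Z :: "(int ^ 2 ^ 2) set" where
  "SL2Z = {A. det A = 1}"

definition SL2Z_act :: "int ^ 2 ^ 2 \<Rightarrow> 'a::real_normed_field \<Rightarrow> 'a" where
  "SL2Z_act A = moebius (of_int (A $ 1 $ 1)) (of_int (A $ 1 $ 2))
                        (of_int (A $ 2 $ 1)) (of_int (A $ 2 $ 2))"

definition weakly_holomorphic_modular_function :: "(complex \<Rightarrow> complex) \<Rightarrow> bool" where
  "weakly_holomorphic_modular_function f \<longleftrightarrow>
     f holomorphic_on upper_half_plane \<and>
     (\<forall>A\<in>SL2Z. \<forall>\<tau>\<in>upper_half_plane. f (SL2Z_act A \<tau>) = f \<tau>) \<and>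
     (\<exists>c :: int \<Rightarrow> complex. finite {n. n < 0 \<and> c n \<noteq> 0} \<and>
        (\<forall>\<tau>\<in>upper_half_plane.
           ((\<lambda>n. c n * exp (2 * of_real pi * \<i> * \<tau>) powi n) has_sum f \<tau>) UNIV))"

definition hyperbolic :: "int ^ 2 ^ 2 \<Rightarrow> bool" where
  "hyperbolic A \<longleftrightarrow> \<bar>trace A\<bar> > 2"

text \<open>The denominator condition keeps the convention \<open>x / 0 = 0\<close> from turning the pole \<open>0\<close>
  of \<open>z \<mapsto> (a z + b) / (c z)\<close> into a fixed point. A hyperbolic element of \<open>SL2Z\<close> does not fix
  \<open>\<infinity>\<close>, so both of its fixed points are real numbers.\<close>

definition fixes_point :: "int ^ 2 ^ 2 \<Rightarrow> real \<Rightarrow> bool" where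
  "fixes_point A x \<longleftrightarrow>
     of_int (A $ 2 $ 1) * x + of_int (A $ 2 $ 2) \<noteq> 0 \<and> SL2Z_act A x = x"

definition attracting_point :: "int ^ 2 ^ 2 \<Rightarrow> real" where
  "attracting_point A = (THE x. fixes_point A x \<and> \<bar>deriv (SL2Z_act A) x\<bar> < 1)"

definition repelling_point :: "int ^ 2 ^ 2 \<Rightarrow> real" where
  "repelling_point A = (THE x. fixes_point A x \<and> \<bar>deriv (SL2Z_act A) x\<bar> > 1)"

text \<open>The triple \<open>(a, b, c)\<close> stands for the form \<open>a x\<^sup>2 + b x y + c y\<^sup>2\<close>.\<close>

type_synonym bqf = "int \<times> int \<times> int"

fun bqf_eval :: "bqf \<Rightarrow> 'a::comm_ring_1 \<Rightarrow> 'a \<Rightarrow> 'a" where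
  "bqf_eval (a, b, c) x y = of_int a * x\<^sup>2 + of_int b * x * y + of_int c * y\<^sup>2"

fun bqf_discr :: "bqf \<Rightarrow> int" where
  "bqf_discr (a, b, c) = b\<^sup>2 - 4 * a * c"

fun bqf_primitive :: "bqf \<Rightarrow> bool" where
  "bqf_primitive (a, b, c) \<longleftrightarrow> Gcd {a, b, c} = 1"

definition bqf_indefinite :: "bqf \<Rightarrow> bool" where
  "bqf_indefinite Q \<longleftrightarrow> bqf_discr Q > 0"

definition assoc_form :: "int ^ 2 ^ 2 \<Rightarrow> bqf" where
  "assoc_form A = (THE Q. bqf_primitive Q \<and> bqf_indefinite Q \<and>
      bqf_eval Q (repelling_point A) 1 = 0 \<and> bqf_eval Q (attracting_point A) 1 = 0 \<and>
      sgn (real_of_int (fst Q)) = sgn (repelling_point A - attracting_point A))"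

text \<open>For \<open>f\<close> a weakly holomorphic modular function, the integral depends neither on the base
  point \<open>\<tau>\<^sub>0\<close> nor on the path joining \<open>\<tau>\<^sub>0\<close> to its image inside the upper half-plane.\<close>

definition cycle_integral :: "(complex \<Rightarrow> complex) \<Rightarrow> int ^ 2 ^ 2 \<Rightarrow> complex" where
  "cycle_integral f A =
     (let Q = assoc_form A; \<tau>\<^sub>0 = (SOME \<tau>. \<tau> \<in> upper_half_plane) in
      contour_integral (linepath \<tau>\<^sub>0 (SL2Z_act A \<tau>\<^sub>0))
        (\<lambda>\<tau>. f \<tau> * of_real (sqrt (of_int (bqf_discr Q))) / bqf_eval Q \<tau> 1))"

definition real_quadratic_irrationality :: "real \<Rightarrow> bool" where
  "real_quadratic_irrationality w \<longleftrightarrow>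
     w \<notin> \<rat> \<and>
     (\<exists>a b c :: int. a \<noteq> 0 \<and> of_int a * w\<^sup>2 + of_int b * w + of_int c = 0)"

text \<open>The quotient does not depend on the choice of \<open>A\<close>. The denominator equals
  \<open>2 log \<epsilon>\<close>, where \<open>\<epsilon> > 1\<close> is the largest absolute value of an eigenvalue of \<open>A\<close>.\<close>

definition modular_val :: "(complex \<Rightarrow> complex) \<Rightarrow> real \<Rightarrow> complex" where
  "modular_val f w =
     (let A = (SOME A. A \<in> SL2Z \<and> hyperbolic A \<and> fixes_point A w) in
      cycle_integral f A / cycle_integral (\<lambda>_. 1) A)"

end

theory Submission imports Defs begin

text \<open>
  Let \<open>\<rho> = e\<^bsup>i\<pi>/3\<^esup>\<close>. Both \<open>T z = z + 1\<close> and \<open>V z = z / (z + 1)\<close> send \<open>\<rho>\<^sup>2\<close> to \<open>\<rho>\<close>. A hyperbolic element is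
  conjugate, up to sign, to a word in \<open>T\<close> and \<open>V\<close> whose attracting fixed point \<open>w\<close> is positive and
  whose repelling fixed point \<open>-n\<close> is negative. Its cycle integral is therefore a sum of integrals
  over the single arc from \<open>\<rho>\<^sup>2\<close> to \<open>\<rho>\<close>, one for each pair \<open>(w\<^sub>k, n\<^sub>k)\<close> of an orbit under the
  Farey map. Folding the arc at \<open>i\<close>, the real part of such an integral is the integral of
  \<open>f (e\<^bsup>it\<^esup>)\<close> against \<open>K s t = s sin t / (s\<^sup>2 - 4 cos\<^sup>2 t)\<close> for \<open>s = w\<^sub>k + 1 / w\<^sub>k\<close> and
  \<open>s = n\<^sub>k + 1 / n\<^sub>k\<close>; for the golden ratio all of these \<open>s\<close> equal \<open>\<surd>5\<close>.

  By Chebyshev's inequality it suffices that \<open>\<Sum> K s t / K (\<surd>5) t\<close> increases on \<open>[\<pi>/3, \<pi>/2]\<close>,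
  and this follows from \<open>\<Sum> s (s\<^sup>2 - 5) / (s\<^sup>2 - 1)\<^sup>2 \<ge> 0\<close>. Single terms may be negative, but along
  the Farey map each one dominates the increment of an explicit potential, so the sum over a
  closed orbit is nonnegative.
\<close>

section \<open>A potential for the Farey map\<close>

text \<open>Put u = 4 cos^2 t. Up to the constant sqrt 5, the ratio of the kernels for s and for
  sqrt 5 is s (5 - u) / (s^2 - u), and minus its derivative in u is s (s^2 - 5) / (s^2 - u)^2. At u
  = 1, the end of the arc, this is \<open>balance s\<close>. That end is the least favourable one:
  relative to the factor 16 / (5 - u)^2, which is common to all s, a smaller u enlarges the positive
  terms and shrinks the negative ones in absolute value. So one number per orbit settles
  monotonicity on the whole half-arc.

  A term is negative exactly when its point lies strictly between 1 / phi and phi. But y + 1 < phi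
  forces y < 1 / phi, hence \<open>inv_sum y\<close> exceeds sqrt 5: every negative term directly
  follows a positive one. The potential stores the surplus of such a point and vanishes where the
  terms are negative, so it is spent at once. The other branch y / (y + 1) is conjugate to the shift
  by inversion, which leaves \<open>inv_sum\<close> unchanged.\<close>

definition inv_sum :: "real \<Rightarrow> real" where
  "inv_sum x = x + 1 / x"

definition balance :: "real \<Rightarrow> real" where
  "balance s = s * (s\<^sup>2 - 5) / (s\<^sup>2 - 1)\<^sup>2"

text \<open>The constant \<open>1 / 4\<close> is a compromise: the limit at infinity must exceed \<open>- balance 2 = 2 / 9\<close>, while
  \<open>potential \<le> balance\<close> should hold beyond \<open>\<surd>5\<close> as far as possible.\<close>

definition potential :: "real \<Rightarrow> real" where
  "potential s = max 0 ((s\<^sup>2 - 5) / (4 * (s\<^sup>2 - 1)))"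

text \<open>The two inverse branches of the Farey map. The type is any field, so that one word acts
  both on real fixed points and on the upper half-plane.\<close>

definition farey :: "bool \<Rightarrow> 'a::field \<Rightarrow> 'a" where
  "farey b z = (if b then z + 1 else z / (z + 1))"

lemma inv_sum_inverse [simp]: "inv_sum (1 / x) = inv_sum x"
  by (simp add: inv_sum_def)

lemma inv_sum_ge_2:
  assumes "x > 0"
  shows "inv_sum x \<ge> 2"
proof -
  have "inv_sum x - 2 = (x - 1)\<^sup>2 / x"
    using assms by (simp add: inv_sum_def field_simps power2_eq_square)
  then show ?thesis
    using assms by (smt (verit) divide_nonneg_pos zero_le_power2)
qed

lemma inv_sum_mono:
  assumes "1 \<le> x" "x \<le> y"
  shows "inv_sum x \<le> inv_sum y"
proof -
  have "inv_sum y - inv_sum x = (y - x) * (x * y - 1) / (x * y)"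
    using assms by (simp add: inv_sum_def field_simps)
  moreover have "x * y \<ge> 1"
    using assms mult_mono[of 1 x 1 y] by simp
  ultimately show ?thesis
    using assms by (smt (verit) divide_nonneg_pos mult_nonneg_nonneg)
qed

text \<open>On positive x the two factors vanish only at phi and at 1 / phi, which locates the sign
  changes of \<open>balance\<close>.\<close>

lemma inv_sum_square_minus_5:
  assumes "x \<noteq> 0"
  shows "(inv_sum x)\<^sup>2 - 5 = (x\<^sup>2 - x - 1) * (x\<^sup>2 + x - 1) / x\<^sup>2"
  using assms by (simp add: inv_sum_def field_simps power2_eq_square)

lemma inv_sum_square_minus_1:
  assumes "x \<noteq> 0"
  shows "(inv_sum x)\<^sup>2 - 1 = (x\<^sup>2 + x + 1) * (x\<^sup>2 - x + 1) / x\<^sup>2"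
  using assms by (simp add: inv_sum_def field_simps power2_eq_square)

text \<open>The hypothesis says y \<le> 1 / phi, so the balance at 1 + y is not positive. It and the
  potential at y share the factor \<open>d\<close>, which vanishes at y = 1 / phi; once it is
  cancelled, a polynomial inequality remains.\<close>

lemma potential_step_small:
  assumes "y > 0" "y\<^sup>2 + y \<le> 1"
  shows "balance (inv_sum (1 + y)) + potential (inv_sum y) \<ge> 0"
proof -
  define P where "P = y\<^sup>2 + 3 * y + 3"
  define R where "R = y\<^sup>2 + y + 1"
  define U where "U = y\<^sup>2 - y + 1"
  define d where "d = 1 - y - y\<^sup>2"
  have y1: "y < 1"
    using assms by (smt (verit) zero_less_power2)
  have pos: "P > 0" "R > 0" "U > 0" "d \<ge> 0"
    unfolding P_def R_def U_def d_def using assms y1 by (smt (verit) zero_le_power2)+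
  define x where "x = 1 + y"
  have x: "x > 0" using assms by (simp add: x_def)
  have s1: "(inv_sum x)\<^sup>2 - 1 = P * R / x\<^sup>2"
  proof -
    have "x\<^sup>2 + x + 1 = P" "x\<^sup>2 - x + 1 = R"
      by (simp_all add: x_def P_def R_def power2_eq_square algebra_simps)
    then show ?thesis using inv_sum_square_minus_1[of x] x by simp
  qed
  have s5: "(inv_sum x)\<^sup>2 - 5 = - d * (y\<^sup>2 + 3 * y + 1) / x\<^sup>2"
  proof -
    have "x\<^sup>2 - x - 1 = - d" "x\<^sup>2 + x - 1 = y\<^sup>2 + 3 * y + 1"
      by (simp_all add: x_def d_def power2_eq_square algebra_simps)
    then show ?thesis using inv_sum_square_minus_5[of x] x by simp
  qed
  have s0: "inv_sum x = (y\<^sup>2 + 2 * y + 2) / x"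
  proof -
    have "x\<^sup>2 + 1 = y\<^sup>2 + 2 * y + 2"
      by (simp add: x_def power2_eq_square algebra_simps)
    then show ?thesis using x by (simp add: inv_sum_def field_simps power2_eq_square)
  qed
  have t1: "(inv_sum y)\<^sup>2 - 1 = R * U / y\<^sup>2"
    using assms inv_sum_square_minus_1[of y] by (simp add: R_def U_def)
  have t5: "(inv_sum y)\<^sup>2 - 5 = d * (1 + y - y\<^sup>2) / y\<^sup>2"
  proof -
    have "(y\<^sup>2 - y - 1) * (y\<^sup>2 + y - 1) = d * (1 + y - y\<^sup>2)"
      by (simp add: d_def power2_eq_square algebra_simps)
    then show ?thesis using assms inv_sum_square_minus_5[of y] by simp
  qed
  have e: "balance (inv_sum x)
      = - d * (x * (y\<^sup>2 + 2 * y + 2) * (y\<^sup>2 + 3 * y + 1)) / (P * R)\<^sup>2"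
  proof -
    have "n / x * (d / x\<^sup>2) / (q / x\<^sup>2)\<^sup>2 = x * n * d / q\<^sup>2" for n d q
      using x by (simp add: power_divide) (simp add: eval_nat_numeral)
    then have "balance (inv_sum x) = x * (y\<^sup>2 + 2 * y + 2) * (- d * (y\<^sup>2 + 3 * y + 1)) / (P * R)\<^sup>2"
      by (simp only: balance_def s1 s5, simp only: s0)
    then show ?thesis by (simp add: mult_ac)
  qed
  have q: "((inv_sum y)\<^sup>2 - 5) / (4 * ((inv_sum y)\<^sup>2 - 1)) = d * (1 + y - y\<^sup>2) / (4 * (R * U))"
    unfolding t1 t5 using assms pos by (simp add: field_simps)
  have key: "4 * x * (y\<^sup>2 + 2 * y + 2) * (y\<^sup>2 + 3 * y + 1) * U \<le> (1 + y - y\<^sup>2) * P\<^sup>2 * R"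
  proof -
    \<comment> \<open>A rational bound slightly above 1 / phi = 0.618...; it suffices to absorb the
      high powers below.\<close>
    have y23: "y \<le> 2 / 3"
    proof (rule ccontr)
      assume "\<not> y \<le> 2 / 3"
      then have "y\<^sup>2 \<ge> (2 / 3)\<^sup>2" by (intro power_mono) auto
      with assms \<open>\<not> y \<le> 2 / 3\<close> show False by (simp add: power2_eq_square)
    qed
    have bound: "y ^ (m + k) \<le> (2 / 3) ^ k * y ^ m" for m k
      using mult_left_mono[OF power_mono[OF y23, of k], of "y ^ m"] assms
      by (simp add: power_add mult.commute)
    have "(1 + y - y\<^sup>2) * P\<^sup>2 * R - 4 * x * (y\<^sup>2 + 2 * y + 2) * (y\<^sup>2 + 3 * y + 1) * U
       = 1 + 4 * y + 24 * y ^ 2 + 26 * y ^ 3 - 17 * y ^ 4 - 46 * y ^ 5 - 34 * y ^ 6 - 10 * y ^ 7 - y ^ 8"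
      unfolding P_def R_def U_def x_def
      by (simp add: algebra_simps power2_eq_square eval_nat_numeral)
    also have "\<dots> \<ge> 0"
    proof -
      \<comment> \<open>\<open>y ^ 5\<close> is charged to the term 26 \<open>y ^ 3\<close> and
        every other negative monomial to 24 \<open>y ^ 2\<close>; both coefficients remain
        positive.\<close>
      have "y ^ 4 \<le> 4 / 9 * y ^ 2" "y ^ 5 \<le> 4 / 9 * y ^ 3" "y ^ 6 \<le> 16 / 81 * y ^ 2"
        "y ^ 7 \<le> 32 / 243 * y ^ 2" "y ^ 8 \<le> 64 / 729 * y ^ 2"
        using bound[of 2 2] bound[of 3 2] bound[of 2 4] bound[of 2 5] bound[of 2 6]
        by (simp_all add: power_divide)
      moreover have "y ^ 2 \<ge> 0" "y ^ 3 \<ge> 0" using assms by auto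
      ultimately show ?thesis using assms by linarith
    qed
    finally show ?thesis by simp
  qed
  have "x * (y\<^sup>2 + 2 * y + 2) * (y\<^sup>2 + 3 * y + 1) / (P * R)\<^sup>2 \<le> (1 + y - y\<^sup>2) / (4 * (R * U))"
  proof -
    have "x * (y\<^sup>2 + 2 * y + 2) * (y\<^sup>2 + 3 * y + 1) * (4 * (R * U)) \<le> (1 + y - y\<^sup>2) * (P * R)\<^sup>2"
      using mult_right_mono[OF key, of R] pos by (simp add: algebra_simps power2_eq_square)
    then show ?thesis
      using pos by (simp add: divide_le_eq pos_le_divide_eq field_simps)
  qed
  from mult_left_mono[OF this \<open>d \<ge> 0\<close>]
  have "- balance (inv_sum x) \<le> ((inv_sum y)\<^sup>2 - 5) / (4 * ((inv_sum y)\<^sup>2 - 1))"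
    unfolding e q by simp
  then show ?thesis
    unfolding potential_def x_def by linarith
qed

text \<open>For large s the balance tends to 0 and falls below the potential, so the increment of
  the potential has to be estimated. A shift raises s by at most 1, which makes the increment of
  order 1 / s^3, against a balance of order 1 / s.\<close>

lemma potential_step_large:
  assumes "y \<ge> 2"
  shows "balance (inv_sum (1 + y)) + potential (inv_sum y) \<ge> potential (inv_sum (1 + y))"
proof -
  define s where "s = inv_sum (1 + y)"
  define u where "u = inv_sum y"
  have s: "s \<ge> 10 / 3" and u: "u \<ge> 5 / 2" and su: "u \<le> s"
    using inv_sum_mono[of 3 "1 + y"] inv_sum_mono[of 2 y] inv_sum_mono[of y "1 + y"] assms
    by (auto simp: s_def u_def inv_sum_def)
  have s2: "s\<^sup>2 \<ge> 100 / 9" and u2: "u\<^sup>2 \<ge> 25 / 4"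
    using power_mono[OF s, of 2] power_mono[OF u, of 2] by (auto simp: power_divide)
  have diff: "s - u \<le> 1"
    using assms by (simp add: s_def u_def inv_sum_def frac_le)
  have pu: "potential u = (u\<^sup>2 - 5) / (4 * (u\<^sup>2 - 1))"
    and ps: "potential s = (s\<^sup>2 - 5) / (4 * (s\<^sup>2 - 1))"
    using s2 u2 by (auto simp: potential_def)
  have "potential s - potential u = (s - u) * (s + u) / ((s\<^sup>2 - 1) * (u\<^sup>2 - 1))"
  proof -
    have "(a - 5) / (4 * (a - 1)) - (c - 5) / (4 * (c - 1)) = (a - c) / ((a - 1) * (c - 1))"
      if "a > 1" "c > 1" for a c :: real
      using that by (simp add: divide_simps) (simp add: algebra_simps)
    from this[of "s\<^sup>2" "u\<^sup>2"] show ?thesis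
      unfolding pu ps using s2 u2 by (simp add: square_diff_square_factored power2_eq_square mult.commute)
  qed
  also have "\<dots> \<le> 2 * s / ((s\<^sup>2 - 1) * (u\<^sup>2 - 1))"
    using diff su s u s2 u2 mult_mono[of "s - u" 1 "s + u" "2 * s"]
    by (intro divide_right_mono) auto
  also have "\<dots> \<le> s * (s\<^sup>2 - 5) / (s\<^sup>2 - 1)\<^sup>2"
  proof -
    \<comment> \<open>21 / 4 = (5 / 2)^2 - 1 is the lower bound for u^2 - 1.\<close>
    have "2 * (s\<^sup>2 - 1) \<le> (s\<^sup>2 - 5) * (21 / 4)"
      using s2 by simp
    also have "\<dots> \<le> (s\<^sup>2 - 5) * (u\<^sup>2 - 1)"
      using s2 u2 by (intro mult_left_mono) auto
    finally have "2 / (u\<^sup>2 - 1) \<le> (s\<^sup>2 - 5) / (s\<^sup>2 - 1)"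
      using s2 u2 by (simp add: field_simps)
    then have "s / (s\<^sup>2 - 1) * (2 / (u\<^sup>2 - 1)) \<le> s / (s\<^sup>2 - 1) * ((s\<^sup>2 - 5) / (s\<^sup>2 - 1))"
      using s s2 by (intro mult_left_mono) auto
    then show ?thesis
      by (simp add: power2_eq_square mult_ac)
  qed
  finally show ?thesis
    by (simp add: balance_def s_def u_def)
qed

text \<open>Below 1 / phi the new potential is 0 and the old one pays. Beyond sqrt 5,
  \<open>potential s\<close> \<le> \<open>balance s\<close> holds as long as s^2 - 1 \<le> 4 s, that
  is, s \<le> 2 + sqrt 5; the cut at y = 2, where s = 10 / 3, stays inside this range.\<close>

lemma potential_step_shift:
  assumes "y > 0"
  shows "balance (inv_sum (1 + y)) + potential (inv_sum y) \<ge> potential (inv_sum (1 + y))"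
proof -
  define s where "s = inv_sum (1 + y)"
  have s_ge: "s \<ge> 2"
    using assms by (simp add: s_def inv_sum_ge_2)
  then have s4: "s\<^sup>2 \<ge> 4"
    using power_mono[of 2 s 2] by simp
  have "s\<^sup>2 - 5 = ((1 + y)\<^sup>2 - (1 + y) - 1) * ((1 + y)\<^sup>2 + (1 + y) - 1) / (1 + y)\<^sup>2"
    using assms by (simp add: s_def inv_sum_square_minus_5)
  moreover have "(1 + y)\<^sup>2 - (1 + y) - 1 = y\<^sup>2 + y - 1" "(1 + y)\<^sup>2 + (1 + y) - 1 = y\<^sup>2 + 3 * y + 1"
    by (simp_all add: power2_eq_square algebra_simps)
  ultimately have s5: "s\<^sup>2 - 5 = (y\<^sup>2 + y - 1) * ((y\<^sup>2 + 3 * y + 1) / (1 + y)\<^sup>2)"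
    by simp
  consider "y\<^sup>2 + y \<le> 1" | "y\<^sup>2 + y \<ge> 1" "y \<le> 2" | "y \<ge> 2" by linarith
  then show ?thesis
  proof cases
    case 1
    then have "s\<^sup>2 - 5 \<le> 0"
      unfolding s5 using assms by (intro mult_nonpos_nonneg) auto
    then have "potential s = 0"
      using s4 by (auto simp: potential_def divide_le_0_iff)
    then show ?thesis
      using potential_step_small[OF assms 1] by (simp add: s_def)
  next
    case 2
    then have nn: "s\<^sup>2 - 5 \<ge> 0"
      unfolding s5 using assms by (intro mult_nonneg_nonneg) auto
    have s_le: "s \<le> 10 / 3"
      using inv_sum_mono[of "1 + y" 3] assms 2 by (auto simp: s_def inv_sum_def)
    have "s * s \<le> s * (10 / 3)"
      using s_le s_ge by (intro mult_left_mono) auto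
    then have "s\<^sup>2 - 1 \<le> 4 * s"
      unfolding power2_eq_square using s_ge by linarith
    then have "1 / 4 \<le> s / (s\<^sup>2 - 1)"
      using s4 by (simp add: field_simps)
    then have "(s\<^sup>2 - 5) / (s\<^sup>2 - 1) * (1 / 4) \<le> (s\<^sup>2 - 5) / (s\<^sup>2 - 1) * (s / (s\<^sup>2 - 1))"
      using nn s4 by (intro mult_left_mono) auto
    then have "potential s \<le> balance s"
      using nn s4 by (simp add: potential_def balance_def power2_eq_square mult_ac)
    moreover have "potential (inv_sum y) \<ge> 0"
      by (simp add: potential_def)
    ultimately show ?thesis
      by (simp add: s_def)
  next
    case 3
    then show ?thesis by (rule potential_step_large)
  qed
qed

lemma farey_pos: "y > 0 \<Longrightarrow> farey b y > (0::real)"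
  by (simp add: farey_def)

lemma potential_step:
  assumes "y > 0"
  shows "balance (inv_sum (farey b y)) \<ge> potential (inv_sum (farey b y)) - potential (inv_sum y)"
proof (cases b)
  case True
  then show ?thesis
    using potential_step_shift[OF assms] by (simp add: farey_def add.commute)
next
  case False
  have "farey b y = 1 / (1 + 1 / y)"
    using False assms by (simp add: farey_def field_simps)
  then show ?thesis
    using potential_step_shift[of "1 / y"] assms by simp
qed

section \<open>Comparison of kernels on the arc\<close>

text \<open>A point t at which r takes its q-weighted mean replaces the usual double integral: when
  the integral of (F x - F t) (r x - r t) q x is expanded, the part with the factor F t
  vanishes.\<close>

lemma chebyshev_integral_inequality:
  fixes F r q :: "real \<Rightarrow> real"
  assumes "a \<le> b"
    and cont: "continuous_on {a..b} F" "continuous_on {a..b} r" "continuous_on {a..b} q"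
    and q: "\<And>x. x \<in> {a..b} \<Longrightarrow> q x \<ge> 0"
    and comonotone: "\<And>x y. x \<in> {a..b} \<Longrightarrow> y \<in> {a..b} \<Longrightarrow> (F x - F y) * (r x - r y) \<ge> 0"
  shows "integral {a..b} (\<lambda>x. F x * q x) * integral {a..b} (\<lambda>x. r x * q x)
    \<le> integral {a..b} (\<lambda>x. F x * (r x * q x)) * integral {a..b} q"
proof -
  have int: "g integrable_on {a..b}" if "continuous_on {a..b} g" for g :: "real \<Rightarrow> real"
    using that by (rule integrable_continuous_real)
  have Iq: "integral {a..b} q \<ge> 0"
    using q int cont by (intro integral_nonneg) auto
  have "\<exists>t\<in>{a..b}. integral {a..b} (\<lambda>x. r x * q x) = r t * integral {a..b} q"
  proof (cases "integral {a..b} q = 0")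
    case True
    obtain B where B: "\<And>x. x \<in> {a..b} \<Longrightarrow> \<bar>r x\<bar> \<le> B"
      using compact_imp_bounded[OF compact_continuous_image[OF cont(2) compact_Icc]]
      unfolding bounded_iff by (metis imageI real_norm_def)
    have "norm (integral {a..b} (\<lambda>x. r x * q x)) \<le> integral {a..b} (\<lambda>x. B * q x)"
      using B q
      by (intro integral_norm_bound_integral int continuous_intros cont)
        (auto simp: abs_mult intro!: mult_right_mono)
    with True have "integral {a..b} (\<lambda>x. r x * q x) = 0" by simp
    with True \<open>a \<le> b\<close> show ?thesis by force
  next
    case False
    with Iq have pos: "integral {a..b} q > 0" by simp
    let ?m = "integral {a..b} (\<lambda>x. r x * q x) / integral {a..b} q"
    obtain x1 where x1: "x1 \<in> {a..b}" "\<And>y. y \<in> {a..b} \<Longrightarrow> r x1 \<le> r y"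
      using continuous_attains_inf[OF compact_Icc _ cont(2)] \<open>a \<le> b\<close> by auto
    obtain x2 where x2: "x2 \<in> {a..b}" "\<And>y. y \<in> {a..b} \<Longrightarrow> r y \<le> r x2"
      using continuous_attains_sup[OF compact_Icc _ cont(2)] \<open>a \<le> b\<close> by auto
    have "integral {a..b} (\<lambda>x. r x1 * q x) \<le> integral {a..b} (\<lambda>x. r x * q x)"
      using x1 q by (intro integral_le int continuous_intros cont mult_right_mono) auto
    then have 1: "r x1 \<le> ?m" using pos by (simp add: field_simps)
    have "integral {a..b} (\<lambda>x. r x * q x) \<le> integral {a..b} (\<lambda>x. r x2 * q x)"
      using x2 q by (intro integral_le int continuous_intros cont mult_right_mono) auto
    then have 2: "?m \<le> r x2" using pos by (simp add: field_simps)
    have "connected (r ` {a..b})"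
      by (intro connected_continuous_image cont connected_Icc)
    with 1 2 x1 x2 have "?m \<in> r ` {a..b}"
      unfolding connected_iff_interval by blast
    then obtain t where t: "t \<in> {a..b}" "r t = ?m" by auto
    from t(2) pos have "integral {a..b} (\<lambda>x. r x * q x) = r t * integral {a..b} q" by simp
    with t(1) show ?thesis by blast
  qed
  then obtain t where t: "t \<in> {a..b}"
    and mean: "integral {a..b} (\<lambda>x. r x * q x) = r t * integral {a..b} q" by blast
  have "0 \<le> integral {a..b} (\<lambda>x. (F x - F t) * (r x - r t) * q x)"
    using comonotone[OF _ t] q
    by (intro integral_nonneg int continuous_intros cont) (auto simp: mult_nonneg_nonneg)
  also have "(\<lambda>x. (F x - F t) * (r x - r t) * q x)
      = (\<lambda>x. F x * (r x * q x) - r t * (F x * q x) - F t * (r x * q x - r t * q x))"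
    by (auto simp: algebra_simps)
  also have "integral {a..b} \<dots> = integral {a..b} (\<lambda>x. F x * (r x * q x)) - r t * integral {a..b} (\<lambda>x. F x * q x)
      - F t * (integral {a..b} (\<lambda>x. r x * q x) - r t * integral {a..b} q)"
    by (subst integral_diff integral_mult_right; (intro int continuous_intros cont)?)+ simp
  finally have "r t * integral {a..b} (\<lambda>x. F x * q x) \<le> integral {a..b} (\<lambda>x. F x * (r x * q x))"
    using mean by simp
  from mult_right_mono[OF this Iq] show ?thesis
    unfolding mean by (simp add: mult_ac)
qed

lemma continuous_on_sum_list:
  fixes g :: "'a \<Rightarrow> 'b::topological_space \<Rightarrow> 'c::topological_monoid_add"
  assumes "\<And>x. x \<in> set xs \<Longrightarrow> continuous_on A (g x)"
  shows "continuous_on A (\<lambda>t. \<Sum>x\<leftarrow>xs. g x t)"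
  using assms by (induction xs) (auto intro!: continuous_intros)

section \<open>Arc kernels and the monotonicity of their ratios\<close>

definition arc_kernel :: "real \<Rightarrow> real \<Rightarrow> real" where
  "arc_kernel s t = s * sin t / (s\<^sup>2 - 4 * (cos t)\<^sup>2)"

abbreviation (input) arc_range :: "real set" where
  "arc_range \<equiv> {pi / 3..2 * pi / 3}"

lemma arc_cos_bound:
  assumes "t \<in> arc_range"
  shows "4 * (cos t)\<^sup>2 \<le> 1"
proof -
  have "cos t \<le> cos (pi / 3)"
    using assms by (intro cos_monotone_0_pi_le) auto
  moreover have "cos (2 * pi / 3) \<le> cos t"
    using assms by (intro cos_monotone_0_pi_le) auto
  ultimately have "\<bar>cos t\<bar> \<le> 1 / 2"
    by (simp add: cos_60 cos_120)
  then have "\<bar>cos t\<bar>\<^sup>2 \<le> (1 / 2)\<^sup>2" by (intro power_mono) auto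
  then show ?thesis by (simp add: power_divide)
qed

lemma arc_sin_pos: "t \<in> arc_range \<Longrightarrow> sin t > 0"
  using pi_gt_zero by (intro sin_gt_zero) (auto simp del: pi_gt_zero)

lemma arc_kernel_denom_pos:
  assumes "t \<in> arc_range" "s \<ge> 2"
  shows "s\<^sup>2 - 4 * (cos t)\<^sup>2 > 0"
  using arc_cos_bound[OF assms(1)] power_mono[OF assms(2), of 2] by simp

lemma continuous_on_arc_kernel [continuous_intros]:
  assumes "s \<ge> 2"
  shows "continuous_on arc_range (arc_kernel s)"
  unfolding arc_kernel_def using arc_kernel_denom_pos[OF _ assms]
  by (intro continuous_intros) force

lemma arc_kernel_pos:
  assumes "t \<in> arc_range" "s \<ge> 2"
  shows "arc_kernel s t > 0"
  unfolding arc_kernel_def using arc_kernel_denom_pos[OF assms] arc_sin_pos[OF assms(1)] assms(2)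
  by auto

text \<open>The factor in front of \<^term>\<open>balance s\<close> does not depend on \<open>s\<close>, so the inequality can be summed.\<close>

lemma balance_term_comparison:
  fixes s u v :: real
  assumes "s \<ge> 2" "0 \<le> u" "u \<le> v" "v \<le> 1"
  shows "s * (5 - u) / (s\<^sup>2 - u) - s * (5 - v) / (s\<^sup>2 - v)
     \<ge> 16 * (v - u) / ((5 - u) * (5 - v)) * balance s"
proof -
  have s4: "s\<^sup>2 \<ge> 4"
    using power_mono[OF assms(1), of 2] by simp
  \<comment> \<open>At x = 1 the quotient (5 - x) / (s^2 - x) equals 4 / (s^2 - 1). A smaller x
    moves it up if s^2 > 5 and down if s^2 < 5, in both cases to the advantage of the
    inequality.\<close>
  have factor: "(s\<^sup>2 - 5) * ((5 - x) / (s\<^sup>2 - x) - 4 / (s\<^sup>2 - 1)) \<ge> 0"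
    if "x \<ge> 0" "x \<le> 1" for x
  proof -
    have "(5 - x) / (s\<^sup>2 - x) - 4 / (s\<^sup>2 - 1)
        = (s\<^sup>2 - 5) * (1 - x) / ((s\<^sup>2 - x) * (s\<^sup>2 - 1))"
      using that s4 by (simp add: divide_simps) (simp add: algebra_simps)
    then have "(s\<^sup>2 - 5) * ((5 - x) / (s\<^sup>2 - x) - 4 / (s\<^sup>2 - 1))
        = (s\<^sup>2 - 5)\<^sup>2 * ((1 - x) / ((s\<^sup>2 - x) * (s\<^sup>2 - 1)))"
      by (simp add: power2_eq_square)
    then show ?thesis using that s4 by simp
  qed
  define A where "A = (5 - u) / (s\<^sup>2 - u)"
  define B where "B = (5 - v) / (s\<^sup>2 - v)"
  define C where "C = 4 / (s\<^sup>2 - 1)"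
  have pos: "A > 0" "B > 0" "C > 0"
    using assms s4 by (auto simp: A_def B_def C_def)
  have "(s\<^sup>2 - 5) * (A * B - C\<^sup>2) = (s\<^sup>2 - 5) * (A - C) * B + (s\<^sup>2 - 5) * (B - C) * C"
    by (simp add: power2_eq_square algebra_simps)
  also have "\<dots> \<ge> 0"
    using mult_nonneg_nonneg[OF factor[of u], of B] mult_nonneg_nonneg[OF factor[of v], of C] assms pos
    unfolding A_def[symmetric] B_def[symmetric] C_def[symmetric] by simp
  finally have AB: "(s\<^sup>2 - 5) * C\<^sup>2 \<le> (s\<^sup>2 - 5) * (A * B)"
    by (simp add: algebra_simps)
  have "s * (5 - u) / (s\<^sup>2 - u) - s * (5 - v) / (s\<^sup>2 - v)
      = s * (v - u) / ((5 - u) * (5 - v)) * ((s\<^sup>2 - 5) * (A * B))"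
    using assms s4 by (simp add: A_def B_def divide_simps) (simp add: algebra_simps)
  moreover have "16 * (v - u) / ((5 - u) * (5 - v)) * balance s
      = s * (v - u) / ((5 - u) * (5 - v)) * ((s\<^sup>2 - 5) * C\<^sup>2)"
    by (simp add: balance_def C_def power_divide) (simp add: algebra_simps)
  moreover have "s * (v - u) / ((5 - u) * (5 - v)) \<ge> 0"
    using assms by auto
  ultimately show ?thesis
    using mult_left_mono[OF AB] by presburger
qed

lemma kernel_ratio_antimono:
  fixes ss :: "real list"
  assumes "\<And>s. s \<in> set ss \<Longrightarrow> s \<ge> 2" "0 \<le> sum_list (map balance ss)"
    and "0 \<le> u" "u \<le> v" "v \<le> 1"
  shows "(\<Sum>s\<leftarrow>ss. s * (5 - v) / (s\<^sup>2 - v)) \<le> (\<Sum>s\<leftarrow>ss. s * (5 - u) / (s\<^sup>2 - u))"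
proof -
  have "16 * (v - u) / ((5 - u) * (5 - v)) * sum_list (map balance ss)
      = (\<Sum>s\<leftarrow>ss. 16 * (v - u) / ((5 - u) * (5 - v)) * balance s)"
    by (rule sum_list_const_mult[symmetric])
  also have "\<dots> \<le> (\<Sum>s\<leftarrow>ss. s * (5 - u) / (s\<^sup>2 - u) - s * (5 - v) / (s\<^sup>2 - v))"
    using assms by (intro sum_list_mono balance_term_comparison) auto
  finally have "16 * (v - u) / ((5 - u) * (5 - v)) * sum_list (map balance ss)
      \<le> (\<Sum>s\<leftarrow>ss. s * (5 - u) / (s\<^sup>2 - u)) - (\<Sum>s\<leftarrow>ss. s * (5 - v) / (s\<^sup>2 - v))"
    by (simp add: sum_list_subtractf)
  moreover have "16 * (v - u) / ((5 - u) * (5 - v)) * sum_list (map balance ss) \<ge> 0"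
    using assms by auto
  ultimately show ?thesis by linarith
qed

text \<open>A comparison of two weighted means of F, cross-multiplied. It is Chebyshev's inequality
  with weight \<open>arc_kernel (sqrt 5)\<close> and density \<open>r\<close>. Both F and
  \<open>r\<close> are symmetric about pi / 2 and increase on the first half of the arc; folding t
  at pi / 2 makes them comonotone on all of it.\<close>

lemma arc_mean_minimal:
  fixes F :: "real \<Rightarrow> real" and ss :: "real list"
  assumes cont: "continuous_on arc_range F"
    and sym: "\<And>t. t \<in> arc_range \<Longrightarrow> F (pi - t) = F t"
    and mono: "mono_on {pi / 3..pi / 2} F"
    and ss: "\<And>s. s \<in> set ss \<Longrightarrow> s \<ge> 2" "0 \<le> sum_list (map balance ss)"
  shows "integral arc_range (\<lambda>t. F t * arc_kernel (sqrt 5) t) * integral arc_range (\<lambda>t. \<Sum>s\<leftarrow>ss. arc_kernel s t)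
    \<le> integral arc_range (\<lambda>t. F t * (\<Sum>s\<leftarrow>ss. arc_kernel s t)) * integral arc_range (arc_kernel (sqrt 5))"
proof -
  define r where "r t = (\<Sum>s\<leftarrow>ss. s * (5 - 4 * (cos t)\<^sup>2) / (s\<^sup>2 - 4 * (cos t)\<^sup>2)) / sqrt 5" for t
  have five: "sqrt 5 \<ge> 2" by (rule real_le_rsqrt) simp
  have r: "r t * arc_kernel (sqrt 5) t = (\<Sum>s\<leftarrow>ss. arc_kernel s t)" if "t \<in> arc_range" for t
  proof -
    have "r t * arc_kernel (sqrt 5) t
        = (\<Sum>s\<leftarrow>ss. s * (5 - 4 * (cos t)\<^sup>2) / (s\<^sup>2 - 4 * (cos t)\<^sup>2)) * (sin t / (5 - 4 * (cos t)\<^sup>2))"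
      by (simp add: r_def arc_kernel_def)
    also have "\<dots> = (\<Sum>s\<leftarrow>ss. s * (5 - 4 * (cos t)\<^sup>2) / (s\<^sup>2 - 4 * (cos t)\<^sup>2) * (sin t / (5 - 4 * (cos t)\<^sup>2)))"
      by (rule sum_list_mult_const[symmetric])
    also have "\<dots> = (\<Sum>s\<leftarrow>ss. arc_kernel s t)"
      using arc_cos_bound[OF that] by (intro arg_cong[where f = sum_list] map_cong) (auto simp: arc_kernel_def)
    finally show ?thesis .
  qed
  have r_mono: "r x \<le> r y" if "x \<in> {pi / 3..pi / 2}" "y \<in> {pi / 3..pi / 2}" "x \<le> y" for x y
  proof -
    have "cos y \<le> cos x" "cos y \<ge> 0"
      using that by (auto intro!: cos_monotone_0_pi_le cos_ge_zero)
    then have "4 * (cos y)\<^sup>2 \<le> 4 * (cos x)\<^sup>2" by simp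
    moreover have "4 * (cos x)\<^sup>2 \<le> 1"
      using that by (intro arc_cos_bound) auto
    ultimately show ?thesis
      unfolding r_def using ss by (intro divide_right_mono kernel_ratio_antimono) auto
  qed
  define fold where "fold t = min t (pi - t)" for t :: real
  have fold: "fold t \<in> {pi / 3..pi / 2}" "F t = F (fold t)" "r t = r (fold t)" if "t \<in> arc_range" for t
    using that sym[OF that] by (auto simp: fold_def min_def r_def)
  have como: "(F x - F y) * (r x - r y) \<ge> 0" if "x \<in> arc_range" "y \<in> arc_range" for x y
  proof -
    note f = fold[OF that(1)] fold[OF that(2)]
    show ?thesis
    proof (cases "fold x \<le> fold y")
      case True
      then show ?thesis
        using f mono_onD[OF mono f(1) f(4)] r_mono[OF f(1) f(4)] by (intro mult_nonpos_nonpos) auto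
    next
      case False
      then show ?thesis
        using f mono_onD[OF mono f(4) f(1)] r_mono[OF f(4) f(1)] by (intro mult_nonneg_nonneg) auto
    qed
  qed
  have cont_r: "continuous_on arc_range r"
  proof -
    have nz: "s\<^sup>2 - 4 * (cos t)\<^sup>2 \<noteq> 0" if "s \<in> set ss" "t \<in> arc_range" for s t
      using arc_kernel_denom_pos[OF that(2) ss(1)[OF that(1)]] by simp
    show ?thesis
      unfolding r_def using nz by (intro continuous_on_divide continuous_on_sum_list continuous_intros) auto
  qed
  have "integral arc_range (\<lambda>t. F t * arc_kernel (sqrt 5) t) * integral arc_range (\<lambda>t. r t * arc_kernel (sqrt 5) t)
    \<le> integral arc_range (\<lambda>t. F t * (r t * arc_kernel (sqrt 5) t)) * integral arc_range (arc_kernel (sqrt 5))"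
    using five by (intro chebyshev_integral_inequality cont cont_r continuous_on_arc_kernel como)
      (auto intro!: less_imp_le arc_kernel_pos)
  moreover have "integral arc_range (\<lambda>t. r t * arc_kernel (sqrt 5) t) = integral arc_range (\<lambda>t. \<Sum>s\<leftarrow>ss. arc_kernel s t)"
    by (intro integral_cong r)
  moreover have "integral arc_range (\<lambda>t. F t * (r t * arc_kernel (sqrt 5) t)) = integral arc_range (\<lambda>t. F t * (\<Sum>s\<leftarrow>ss. arc_kernel s t))"
    by (intro integral_cong) (simp add: r)
  ultimately show ?thesis by simp
qed

section \<open>Contour integrals in the upper half-plane\<close>

lemma in_upper_half_plane [simp]: "z \<in> upper_half_plane \<longleftrightarrow> Im z > 0"
  by (simp add: upper_half_plane_def)

lemma convex_upper_half_plane: "convex upper_half_plane"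
  using convex_halfspace_Im_gt[of 0] by (simp add: upper_half_plane_def)

lemma open_upper_half_plane: "open upper_half_plane"
  using open_halfspace_Im_gt[of 0] by (simp add: upper_half_plane_def)

text \<open>Cycle integrals are defined on segments, while the argument needs arcs and Moebius
  images of segments. A primitive on the convex half-plane reduces all of these to differences of
  end values and so avoids deforming paths.\<close>

lemma holomorphic_upper_half_plane_primitive:
  assumes "g holomorphic_on upper_half_plane"
  shows "\<exists>P. (\<forall>z\<in>upper_half_plane. (P has_field_derivative g z) (at z)) \<and>
    (\<forall>a\<in>upper_half_plane. \<forall>b\<in>upper_half_plane. contour_integral (linepath a b) g = P b - P a)"
proof -
  obtain P where P: "\<And>z. z \<in> upper_half_plane \<Longrightarrow> (P has_field_derivative g z) (at z within upper_half_plane)"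
    using holomorphic_convex_primitive'[OF convex_upper_half_plane open_upper_half_plane assms] by blast
  have "contour_integral (linepath a b) g = P b - P a"
    if "a \<in> upper_half_plane" "b \<in> upper_half_plane" for a b
    using contour_integral_primitive[OF P, of "linepath a b"] that
      closed_segment_subset[OF that convex_upper_half_plane]
    by (intro contour_integral_unique) auto
  moreover have "(P has_field_derivative g z) (at z)" if "z \<in> upper_half_plane" for z
    using P[OF that] that at_within_open[OF that open_upper_half_plane] by simp
  ultimately show ?thesis by blast
qed

lemma contour_integral_linepath_join:
  assumes "g holomorphic_on upper_half_plane"
    and "a \<in> upper_half_plane" "b \<in> upper_half_plane" "c \<in> upper_half_plane"
  shows "contour_integral (linepath a c) g
       = contour_integral (linepath a b) g + contour_integral (linepath b c) g"
proof -
  obtain P where "\<forall>a\<in>upper_half_plane. \<forall>b\<in>upper_half_plane. contour_integral (linepath a b) g = P b - P a"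
    using holomorphic_upper_half_plane_primitive[OF assms(1)] by blast
  with assms show ?thesis by simp
qed

section \<open>Integral Moebius transformations and invariant differential forms\<close>

abbreviation imoebius :: "int \<Rightarrow> int \<Rightarrow> int \<Rightarrow> int \<Rightarrow> 'a::field \<Rightarrow> 'a" where
  "imoebius p q r s \<equiv> moebius (of_int p) (of_int q) (of_int r) (of_int s)"

lemma moebius_denom_nonzero:
  assumes "z \<in> upper_half_plane" "p * s - q * r = (1::int)"
  shows "of_int r * z + of_int s \<noteq> 0"
proof
  assume 0: "of_int r * z + of_int s = 0"
  then have "Im (of_int r * z + of_int s) = 0" by simp
  then have "r = 0" using assms(1) by simp
  with 0 have "s = 0" by simp
  with \<open>r = 0\<close> assms(2) show False by simp
qed

lemma imoebius_upper_half_plane: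
  assumes "z \<in> upper_half_plane" "p * s - q * r = 1"
  shows "imoebius p q r s z \<in> upper_half_plane"
proof -
  let ?d = "of_int r * z + of_int s :: complex"
  have nz: "?d \<noteq> 0" using moebius_denom_nonzero[OF assms] .
  have "real_of_int p * s - real_of_int q * r = 1"
    using assms(2) by (metis of_int_1 of_int_diff of_int_mult)
  moreover have "Im ((of_int p * z + of_int q) * cnj ?d) = (real_of_int p * s - real_of_int q * r) * Im z"
    by (simp add: algebra_simps)
  ultimately have *: "Im ((of_int p * z + of_int q) * cnj ?d) = Im z" by simp
  have "imoebius p q r s z = (of_int p * z + of_int q) * cnj ?d / of_real ((cmod ?d)\<^sup>2)"
    unfolding moebius_def by (subst complex_div_cnj) simp
  then have "Im (imoebius p q r s z) = Im z / (cmod ?d)\<^sup>2"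
    using * by (simp only: Im_divide_of_real)
  with nz assms(1) show ?thesis by simp
qed

lemma has_field_derivative_imoebius:
  fixes z :: "'a::real_normed_field"
  assumes "of_int r * z + of_int s \<noteq> 0" "p * s - q * r = 1"
  shows "(imoebius p q r s has_field_derivative 1 / (of_int r * z + of_int s)\<^sup>2) (at z)"
proof -
  have "of_int p * of_int s - of_int q * of_int r = (1::'a)"
    using assms(2) by (metis of_int_1 of_int_diff of_int_mult)
  then have "of_int p * (of_int r * z + of_int s) - (of_int p * z + of_int q) * of_int r = (1::'a)"
    by (simp add: algebra_simps)
  then show ?thesis
    unfolding moebius_def
    by (auto intro!: derivative_eq_intros simp: assms(1) power2_eq_square)
qed

text \<open>Equals \<open>\<surd>D / Q(z, 1)\<close> when \<open>a\<close> and \<open>b\<close> are the attracting and repelling fixed points.\<close>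

definition geodesic_form :: "real \<Rightarrow> real \<Rightarrow> complex \<Rightarrow> complex" where
  "geodesic_form a b z = 1 / (z - of_real b) - 1 / (z - of_real a)"

lemma geodesic_form_holomorphic: "geodesic_form a b holomorphic_on upper_half_plane"
  unfolding geodesic_form_def by (intro holomorphic_intros) auto

text \<open>The form with a single pole is not invariant, but the error term does not depend on the
  pole x. It therefore cancels in the difference that defines \<open>geodesic_form\<close>.\<close>

lemma cauchy_kernel_imoebius:
  fixes x :: real
  assumes "z \<in> upper_half_plane" "p * s - q * r = 1" "of_int r * x + of_int s \<noteq> 0"
  shows "1 / (imoebius p q r s z - of_real (imoebius p q r s x)) * (1 / (of_int r * z + of_int s)\<^sup>2)
       = 1 / (z - of_real x) - of_int r / (of_int r * z + of_int s)"
proof -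
  define d where "d = of_int r * z + (of_int s :: complex)"
  define e where "e = of_int r * of_real x + (of_int s :: complex)"
  have d: "d \<noteq> 0" unfolding d_def using moebius_denom_nonzero[OF assms(1,2)] .
  have "e = of_real (of_int r * x + of_int s)" by (simp add: e_def)
  with assms(3) have e: "e \<noteq> 0" by (metis of_real_eq_0_iff)
  have zx: "z - of_real x \<noteq> 0" using assms(1) by auto
  have det: "of_int p * of_int s - of_int q * of_int r = (1::complex)"
    using assms(2) by (metis of_int_1 of_int_diff of_int_mult)
  have "imoebius p q r s z - of_real (imoebius p q r s x)
      = (of_int p * z + of_int q) / d - (of_int p * of_real x + of_int q) / e"
    by (simp add: moebius_def d_def e_def)
  also have "\<dots> = ((of_int p * z + of_int q) * e - (of_int p * of_real x + of_int q) * d) / (d * e)"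
    using d e by (simp add: divide_simps)
  also have "(of_int p * z + of_int q) * e - (of_int p * of_real x + of_int q) * d
      = (of_int p * of_int s - of_int q * of_int r) * (z - of_real x)"
    by (simp add: d_def e_def algebra_simps)
  finally have "imoebius p q r s z - of_real (imoebius p q r s x) = (z - of_real x) / (d * e)"
    by (simp add: det)
  then have "1 / (imoebius p q r s z - of_real (imoebius p q r s x)) * (1 / d\<^sup>2) = e / (d * (z - of_real x))"
    using d e zx by (simp add: power2_eq_square)
  also have "e = d - of_int r * (z - of_real x)"
    by (simp add: d_def e_def algebra_simps)
  also have "(d - of_int r * (z - of_real x)) / (d * (z - of_real x)) = 1 / (z - of_real x) - of_int r / d"
    using d zx by (simp add: divide_simps)
  finally show ?thesis unfolding d_def .
qed

lemma geodesic_form_imoebius: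
  assumes "z \<in> upper_half_plane" "p * s - q * r = 1"
    and "of_int r * a + of_int s \<noteq> 0" "of_int r * b + of_int s \<noteq> 0"
  shows "geodesic_form (imoebius p q r s a) (imoebius p q r s b) (imoebius p q r s z)
      * (1 / (of_int r * z + of_int s)\<^sup>2) = geodesic_form a b z"
  using cauchy_kernel_imoebius[OF assms(1,2,3)] cauchy_kernel_imoebius[OF assms(1,2,4)]
  unfolding geodesic_form_def left_diff_distrib by simp

text \<open>The constant 1 is an instance as well, so numerator and denominator of a value undergo
  the same decomposition.\<close>

locale modular_invariant =
  fixes f :: "complex \<Rightarrow> complex"
  assumes holomorphic: "f holomorphic_on upper_half_plane"
    and invariant: "p * s - q * r = 1 \<Longrightarrow> z \<in> upper_half_plane \<Longrightarrow> f (imoebius p q r s z) = f z"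
begin

definition geodesic_integral :: "real \<Rightarrow> real \<Rightarrow> complex \<Rightarrow> complex \<Rightarrow> complex" where
  "geodesic_integral a b z z' = contour_integral (linepath z z') (\<lambda>\<tau>. f \<tau> * geodesic_form a b \<tau>)"

lemma form_holomorphic: "(\<lambda>\<tau>. f \<tau> * geodesic_form a b \<tau>) holomorphic_on upper_half_plane"
  by (intro holomorphic_intros holomorphic geodesic_form_holomorphic)

lemma geodesic_integral_join:
  assumes "x \<in> upper_half_plane" "y \<in> upper_half_plane" "z \<in> upper_half_plane"
  shows "geodesic_integral a b x z = geodesic_integral a b x y + geodesic_integral a b y z"
  unfolding geodesic_integral_def using contour_integral_linepath_join[OF form_holomorphic assms] .

text \<open>The image of a segment need not be a segment, so the substitution is made on the
  primitive: \<open>P\<close> composed with the transformation is a primitive of the pulled-back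
  form.\<close>

lemma geodesic_integral_imoebius:
  assumes det: "p * s - q * r = 1"
    and ab: "of_int r * a + of_int s \<noteq> 0" "of_int r * b + of_int s \<noteq> 0"
    and z: "z \<in> upper_half_plane" "z' \<in> upper_half_plane"
  shows "geodesic_integral (imoebius p q r s a) (imoebius p q r s b) (imoebius p q r s z) (imoebius p q r s z')
       = geodesic_integral a b z z'"
proof -
  let ?M = "imoebius p q r s :: complex \<Rightarrow> complex"
  let ?g = "\<lambda>\<tau>. f \<tau> * geodesic_form (imoebius p q r s a) (imoebius p q r s b) \<tau>"
  obtain P where P: "\<forall>z\<in>upper_half_plane. (P has_field_derivative ?g z) (at z)"
    "\<forall>a\<in>upper_half_plane. \<forall>b\<in>upper_half_plane. contour_integral (linepath a b) ?g = P b - P a"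
    using holomorphic_upper_half_plane_primitive[OF form_holomorphic[of "imoebius p q r s a" "imoebius p q r s b"]] by blast
  have "((\<lambda>\<tau>. P (?M \<tau>)) has_field_derivative f \<tau> * geodesic_form a b \<tau>) (at \<tau>)"
    if \<tau>: "\<tau> \<in> upper_half_plane" for \<tau>
  proof -
    have "((\<lambda>\<tau>. P (?M \<tau>)) has_field_derivative ?g (?M \<tau>) * (1 / (of_int r * \<tau> + of_int s)\<^sup>2)) (at \<tau>)"
      by (rule DERIV_chain'[OF has_field_derivative_imoebius P(1)[rule_format]])
        (use moebius_denom_nonzero[OF \<tau> det] imoebius_upper_half_plane[OF \<tau> det] det in simp_all)
    then show ?thesis
      unfolding mult.assoc geodesic_form_imoebius[OF \<tau> det ab] invariant[OF det \<tau>] .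
  qed
  then have "((\<lambda>\<tau>. f \<tau> * geodesic_form a b \<tau>) has_contour_integral P (?M z') - P (?M z)) (linepath z z')"
    using contour_integral_primitive[of upper_half_plane "\<lambda>\<tau>. P (?M \<tau>)"
        "\<lambda>\<tau>. f \<tau> * geodesic_form a b \<tau>" "linepath z z'"]
      closed_segment_subset[OF z convex_upper_half_plane]
    by (simp add: has_field_derivative_at_within)
  then have "geodesic_integral a b z z' = P (?M z') - P (?M z)"
    unfolding geodesic_integral_def by (rule contour_integral_unique)
  moreover have "geodesic_integral (imoebius p q r s a) (imoebius p q r s b) (?M z) (?M z') = P (?M z') - P (?M z)"
    unfolding geodesic_integral_def using P(2) imoebius_upper_half_plane[OF _ det] z by blast
  ultimately show ?thesis by simp
qed

end

abbreviation rho :: complex where "rho \<equiv> cis (pi / 3)"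
abbreviation rho2 :: complex where "rho2 \<equiv> cis (2 * pi / 3)"

lemma cis_arc_upper: "t \<in> arc_range \<Longrightarrow> cis t \<in> upper_half_plane"
  using arc_sin_pos by simp

text \<open>The minus sign is due to orientation: as t increases, \<open>cis t\<close> runs from
  \<open>rho\<close> to \<open>rho2\<close>.\<close>

lemma arc_integral:
  assumes "g holomorphic_on upper_half_plane"
  shows "((\<lambda>t. - (g (cis t) * (\<i> * cis t))) has_integral contour_integral (linepath rho2 rho) g) arc_range"
proof -
  obtain P where P: "\<forall>z\<in>upper_half_plane. (P has_field_derivative g z) (at z)"
    "\<forall>a\<in>upper_half_plane. \<forall>b\<in>upper_half_plane. contour_integral (linepath a b) g = P b - P a"
    using holomorphic_upper_half_plane_primitive[OF assms] by blast
  have "((\<lambda>t. g (cis t) * (\<i> * cis t)) has_integral (P (cis (2 * pi / 3)) - P (cis (pi / 3)))) arc_range"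
  proof (rule fundamental_theorem_of_calculus)
    show "((\<lambda>t. P (cis t)) has_vector_derivative g (cis t) * (\<i> * cis t)) (at t within arc_range)"
      if "t \<in> arc_range" for t
    proof -
      have "(cis has_vector_derivative \<i> * cis t) (at t within arc_range)"
        unfolding has_vector_derivative_def
        by (rule has_derivative_eq_rhs[OF has_derivative_cis[OF has_derivative_ident]])
          (simp add: fun_eq_iff scaleR_conv_of_real mult_ac)
      then show ?thesis
        using field_vector_diff_chain_within[of cis "\<i> * cis t" t arc_range P "g (cis t)"] P(1)[rule_format, OF cis_arc_upper[OF that]]
        by (simp add: o_def mult.commute has_field_derivative_at_within)
    qed
  qed simp
  from has_integral_neg[OF this] show ?thesis
    using P(2)[rule_format, of rho2 rho] cis_arc_upper[of "pi / 3"] cis_arc_upper[of "2 * pi / 3"] by simp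
qed

section \<open>Integrals over the arc\<close>

text \<open>The pull-back of \<open>geodesic_form w (- n)\<close> along the arc taken from
  \<open>rho2\<close> to \<open>rho\<close>; the sign of the reversed orientation is absorbed by the
  order of the two fractions. Writing the repelling point as - n keeps both parameters
  positive.\<close>

definition arc_form :: "real \<Rightarrow> real \<Rightarrow> real \<Rightarrow> complex" where
  "arc_form w n t = \<i> * cis t * (1 / (cis t - of_real w) - 1 / (cis t + of_real n))"

lemma cis_pi_minus: "cis (pi - t) = - cnj (cis t)"
  by (simp add: complex_eq_iff)

text \<open>The reflection of the arc in the imaginary axis sends the end points w and - n of the
  geodesic to - w and n, hence exchanges the two parameters.\<close>

lemma arc_form_reflect: "arc_form w n (pi - t) = cnj (arc_form n w t)"
proof -
  let ?c = "cnj (cis t)"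
  have "- ?c - of_real w = - (?c + of_real w)" "- ?c + of_real n = - (?c - of_real n)" by simp_all
  then have "arc_form w n (pi - t) = \<i> * (- ?c) * (- (1 / (?c + of_real w)) - - (1 / (?c - of_real n)))"
    unfolding arc_form_def cis_pi_minus by (simp only: divide_minus_right)
  also have "\<dots> = cnj (arc_form n w t)"
    by (simp add: arc_form_def right_diff_distrib)
  finally show ?thesis .
qed

lemma Re_arc_form_term:
  assumes "t \<in> arc_range"
  shows "Re (\<i> * cis t / (cis t - of_real w)) = w * sin t / (1 + w\<^sup>2 - 2 * w * cos t)"
proof -
  have sq: "(sin t)\<^sup>2 + (cos t)\<^sup>2 = 1" by simp
  have d: "(cmod (cis t - of_real w))\<^sup>2 = 1 + w\<^sup>2 - 2 * w * cos t"
    unfolding cmod_power2 using sq by (simp add: power2_eq_square algebra_simps)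
  have "\<i> * cis t / (cis t - of_real w)
      = \<i> * cis t * cnj (cis t - of_real w) / of_real ((cmod (cis t - of_real w))\<^sup>2)"
    by (subst complex_div_cnj) simp
  also have "Re \<dots> = Re (\<i> * cis t * cnj (cis t - of_real w)) / (1 + w\<^sup>2 - 2 * w * cos t)"
    unfolding d by (rule Re_divide_of_real)
  also have "Re (\<i> * cis t * cnj (cis t - of_real w)) = w * sin t"
    by (simp add: algebra_simps)
  finally show ?thesis .
qed

text \<open>Since 1 + w^2 = w s for s = \<open>inv_sum w\<close>, the factor w cancels and the
  summands become sin t / (s - 2 cos t) and sin t / (s + 2 cos t). After folding, the integrand thus
  depends on w only through \<open>inv_sum w\<close>.\<close>

lemma arc_kernel_symmetrized:
  assumes "t \<in> arc_range" "w > 0"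
  shows "w * sin t / (1 + w\<^sup>2 - 2 * w * cos t) + w * sin t / (1 + w\<^sup>2 + 2 * w * cos t)
       = 2 * arc_kernel (inv_sum w) t"
proof -
  define s where "s = inv_sum w"
  define c where "c = 2 * cos t"
  have sw: "1 + w\<^sup>2 = w * s"
    using assms(2) by (simp add: s_def inv_sum_def power2_eq_square algebra_simps)
  have "s\<^sup>2 - c\<^sup>2 > 0"
    using arc_kernel_denom_pos[OF assms(1) inv_sum_ge_2[OF assms(2)]]
    by (simp add: s_def c_def power2_eq_square)
  then have nz: "s - c \<noteq> 0" "s + c \<noteq> 0" "s\<^sup>2 - c\<^sup>2 \<noteq> 0"
    by (auto simp: square_diff_square_factored power2_eq_square)
  have "w * sin t / (1 + w\<^sup>2 - 2 * w * cos t) = w * sin t / (w * (s - c))"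
    "w * sin t / (1 + w\<^sup>2 + 2 * w * cos t) = w * sin t / (w * (s + c))"
    unfolding sw c_def by (simp_all add: algebra_simps)
  then have "w * sin t / (1 + w\<^sup>2 - 2 * w * cos t) + w * sin t / (1 + w\<^sup>2 + 2 * w * cos t)
      = sin t / (s - c) + sin t / (s + c)"
    using assms(2) by simp
  also have "\<dots> = 2 * (s * sin t / (s\<^sup>2 - c\<^sup>2))"
    using nz unfolding power2_eq_square square_diff_square_factored by (simp add: divide_simps) (simp add: algebra_simps)
  finally show ?thesis
    by (simp add: arc_kernel_def s_def c_def power_mult_distrib)
qed

lemma Re_arc_form_symmetrized:
  assumes "t \<in> arc_range" "w > 0" "n > 0"
  shows "Re (arc_form w n t) + Re (arc_form n w t)
       = 2 * (arc_kernel (inv_sum w) t + arc_kernel (inv_sum n) t)"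
proof -
  have "Re (arc_form w n t) = w * sin t / (1 + w\<^sup>2 - 2 * w * cos t) + n * sin t / (1 + n\<^sup>2 + 2 * n * cos t)" for w n
  proof -
    have "arc_form w n t = \<i> * cis t / (cis t - of_real w) - \<i> * cis t / (cis t - of_real (- n))"
      by (simp add: arc_form_def algebra_simps)
    then have "Re (arc_form w n t) = Re (\<i> * cis t / (cis t - of_real w)) - Re (\<i> * cis t / (cis t - of_real (- n)))"
      by (simp only: minus_complex.simps)
    then show ?thesis
      unfolding Re_arc_form_term[OF assms(1)] by simp
  qed
  then show ?thesis
    using arc_kernel_symmetrized[OF assms(1,2)] arc_kernel_symmetrized[OF assms(1,3)] by simp
qed

lemma has_integral_arc_reflect:
  assumes "(g has_integral I) arc_range"
  shows "((\<lambda>t. g (pi - t)) has_integral I) arc_range"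
proof -
  have "(g \<circ> (+) pi has_integral I) {- (2 * pi / 3)..- (pi / 3)}"
    using assms by (simp add: has_integral_shift_Icc_real)
  then have "((\<lambda>t. (g \<circ> (+) pi) (- t)) has_integral I) {- (- (pi / 3))..- (- (2 * pi / 3))}"
    by (subst has_integral_reflect_real)
  then show ?thesis by (simp add: o_def)
qed

context modular_invariant
begin

definition arc_term :: "real \<Rightarrow> real \<Rightarrow> complex" where
  "arc_term w n = geodesic_integral w (- n) rho2 rho"

lemma arc_has_integral: "((\<lambda>t. f (cis t) * arc_form w n t) has_integral arc_term w n) arc_range"
proof -
  have "- (f (cis t) * geodesic_form w (- n) (cis t) * (\<i> * cis t)) = f (cis t) * arc_form w n t" for t
    by (simp add: geodesic_form_def arc_form_def algebra_simps)
  with arc_integral[OF form_holomorphic[of w "- n"]] show ?thesis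
    by (simp add: arc_term_def geodesic_integral_def)
qed

text \<open>On the unit circle - 1 / z is the reflection of z in the imaginary axis, so modular
  inversion acts on the arc by t -> pi - t.\<close>

lemma arc_reflect: "t \<in> arc_range \<Longrightarrow> f (cis (pi - t)) = f (cis t)"
proof -
  assume t: "t \<in> arc_range"
  have "imoebius 0 (- 1) 1 0 (cis t) = cis (pi - t)"
    by (simp add: moebius_def cis_pi_minus cis_cnj divide_inverse)
  with invariant[of 0 0 "- 1" 1, OF _ cis_arc_upper[OF t]] show ?thesis by simp
qed

lemma continuous_on_arc: "continuous_on arc_range (\<lambda>t. f (cis t))"
  using cis_arc_upper
  by (intro continuous_on_compose2[OF holomorphic_on_imp_continuous_on[OF holomorphic]] continuous_intros) auto

end

locale modular_real_on_arc = modular_invariant +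
  assumes real_on_arc: "t \<in> arc_range \<Longrightarrow> f (cis t) \<in> \<real>"
begin

text \<open>Reality of f on the arc lets conjugation pass through the reflected integrand. The
  result is used twice: to replace the real part of a term by its average with the swapped one, and
  to cancel imaginary parts along the orbit of the golden ratio.\<close>

lemma arc_swap: "arc_term n w = cnj (arc_term w n)"
proof -
  have "((\<lambda>t. f (cis (pi - t)) * arc_form w n (pi - t)) has_integral arc_term w n) arc_range"
    using has_integral_arc_reflect[OF arc_has_integral] .
  then have "((\<lambda>t. cnj (f (cis t) * arc_form n w t)) has_integral arc_term w n) arc_range"
    by (rule has_integral_eq[rotated])
      (use arc_reflect real_on_arc in \<open>auto simp: arc_form_reflect Reals_cnj_iff\<close>)
  then have "(cnj \<circ> (\<lambda>t. f (cis t) * arc_form n w t) has_integral cnj (cnj (arc_term w n))) arc_range"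
    by (simp add: o_def)
  then have "((\<lambda>t. f (cis t) * arc_form n w t) has_integral cnj (arc_term w n)) arc_range"
    by (subst (asm) has_integral_cnj)
  with arc_has_integral[of n w] show ?thesis
    by (rule has_integral_unique)
qed

lemma Re_arc_has_integral:
  assumes "w > 0" "n > 0"
  shows "((\<lambda>t. Re (f (cis t)) * (arc_kernel (inv_sum w) t + arc_kernel (inv_sum n) t)) has_integral Re (arc_term w n)) arc_range"
proof -
  have "((\<lambda>t. (Re (f (cis t) * arc_form w n t) + Re (f (cis t) * arc_form n w t)) / 2) has_integral
      (Re (arc_term w n) + Re (arc_term n w)) / 2) arc_range"
    by (intro has_integral_divide has_integral_add arc_has_integral
        has_integral_linear[OF _ bounded_linear_Re, unfolded o_def])
  then have "((\<lambda>t. (Re (f (cis t) * arc_form w n t) + Re (f (cis t) * arc_form n w t)) / 2) has_integral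
      Re (arc_term w n)) arc_range"
    by (simp add: arc_swap[of n w])
  then show ?thesis
  proof (rule has_integral_eq[rotated])
    fix t assume t: "t \<in> arc_range"
    have avg: "(Re (arc_form w n t) + Re (arc_form n w t)) / 2
        = arc_kernel (inv_sum w) t + arc_kernel (inv_sum n) t"
      using Re_arc_form_symmetrized[OF t assms] by simp
    have "Im (f (cis t)) = 0" using real_on_arc[OF t] by (simp add: complex_is_Real_iff)
    then have "(Re (f (cis t) * arc_form w n t) + Re (f (cis t) * arc_form n w t)) / 2
       = Re (f (cis t)) * ((Re (arc_form w n t) + Re (arc_form n w t)) / 2)"
      by (simp add: algebra_simps)
    then show "(Re (f (cis t) * arc_form w n t) + Re (f (cis t) * arc_form n w t)) / 2
       = Re (f (cis t)) * (arc_kernel (inv_sum w) t + arc_kernel (inv_sum n) t)"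
      by (simp only: avg)
  qed
qed

end

section \<open>Words in the Farey maps\<close>

primrec word_act :: "bool list \<Rightarrow> 'a::field \<Rightarrow> 'a" where
  "word_act [] z = z"
| "word_act (b # bs) z = farey b (word_act bs z)"

text \<open>If the word \<open>M\<close> acts by \<open>word_act\<close>, then \<open>back_act\<close> is \<open>n \<mapsto> - M\<^sup>-\<^sup>1 (- n)\<close>.\<close>

primrec back_act :: "bool list \<Rightarrow> real \<Rightarrow> real" where
  "back_act [] n = n"
| "back_act (b # bs) n = back_act bs (farey b n)"

text \<open>Successive pull-backs of the geodesic from - n to \<open>word_act bs w\<close>. Undoing
  a letter strips it from the attracting point, while on a negative point - n the inverse letter
  acts as - \<open>farey b n\<close>; so both components remain positive.\<close>

primrec orbit :: "bool list \<Rightarrow> real \<Rightarrow> real \<Rightarrow> (real \<times> real) list" where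
  "orbit [] w n = []"
| "orbit (b # bs) w n = (word_act (b # bs) w, n) # orbit bs w (farey b n)"

lemma word_act_pos: "w > 0 \<Longrightarrow> word_act bs w > (0::real)"
  by (induction bs) (auto intro: farey_pos)

lemma orbit_pos:
  assumes "w > 0" "n > 0" "(x, m) \<in> set (orbit bs w n)"
  shows "x > 0" "m > 0"
  using assms(2,3)
  by (induction bs arbitrary: n) (auto intro!: farey_pos word_act_pos[OF assms(1)])

definition orbit_traces :: "(real \<times> real) list \<Rightarrow> real list" where
  "orbit_traces xs = concat (map (\<lambda>(x, m). [inv_sum x, inv_sum m]) xs)"

lemma orbit_traces_simps [simp]:
  "orbit_traces [] = []"
  "orbit_traces ((x, m) # xs) = inv_sum x # inv_sum m # orbit_traces xs"
  by (simp_all add: orbit_traces_def)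

text \<open>The two components run through the Farey map in opposite directions. The potential bounds
  \<open>balance\<close> at the later value of the second component, hence the boundary term in \<open>balance\<close>.\<close>

lemma orbit_balance:
  assumes "w > 0" "n > 0"
  shows "sum_list (map balance (orbit_traces (orbit bs w n)))
    \<ge> potential (inv_sum (word_act bs w)) - potential (inv_sum w)
      + (potential (inv_sum (back_act bs n)) - potential (inv_sum n))
      - (balance (inv_sum (back_act bs n)) - balance (inv_sum n))"
  using assms(2)
proof (induction bs arbitrary: n)
  case (Cons b bs)
  have "farey b n > 0" using Cons.prems by (rule farey_pos)
  from Cons.IH[OF this] potential_step[OF Cons.prems, of b] potential_step[OF word_act_pos[OF assms(1), of bs], of b]
  show ?case by simp
qed simp

lemma orbit_traces_ge_2:
  assumes "w > 0" "n > 0" "s \<in> set (orbit_traces (orbit bs w n))"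
  shows "s \<ge> 2"
  using assms(3) orbit_pos[OF assms(1,2)] by (auto simp: orbit_traces_def intro: inv_sum_ge_2)

section \<open>Cutting an integral along the letters of a word\<close>

lemma farey_imoebius:
  "farey b z = (if b then imoebius 1 1 0 1 z else imoebius 1 0 1 1 z)"
  by (simp add: farey_def moebius_def)

lemma farey_upper_half_plane: "z \<in> upper_half_plane \<Longrightarrow> farey b z \<in> upper_half_plane"
  unfolding farey_imoebius using imoebius_upper_half_plane[of z 1 1 1 0] imoebius_upper_half_plane[of z 1 1 0 1]
  by (simp del: in_upper_half_plane)

lemma word_act_upper_half_plane: "z \<in> upper_half_plane \<Longrightarrow> word_act bs z \<in> upper_half_plane"
  by (induction bs) (simp_all add: farey_upper_half_plane del: in_upper_half_plane)

lemma farey_rho2: "farey b rho2 = rho"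
proof -
  have shift: "rho2 + 1 = rho"
    by (simp add: complex_eq_iff cos_60 cos_120 sin_60 sin_120)
  have "rho2 / rho = rho"
    by (simp add: cis_divide)
  with shift show ?thesis by (simp add: farey_def)
qed

lemma rho_upper: "rho \<in> upper_half_plane" "rho2 \<in> upper_half_plane"
  using cis_arc_upper[of "pi / 3"] cis_arc_upper[of "2 * pi / 3"] by auto

context modular_invariant
begin

lemma geodesic_integral_farey:
  assumes "w > 0" "n > 0" "z \<in> upper_half_plane" "z' \<in> upper_half_plane"
  shows "geodesic_integral (farey b w) (- n) (farey b z) (farey b z') = geodesic_integral w (- farey b n) z z'"
proof (cases b)
  case True
  then show ?thesis
    using geodesic_integral_imoebius[of 1 1 1 0 w "- farey b n" z z'] assms
    by (simp add: farey_def moebius_def)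
next
  case False
  have 1: "1 - n / (n + 1) = 1 / (n + 1)" using assms(2) by (simp add: field_simps)
  have "imoebius 1 0 1 1 (- farey b n) = - n"
    using False assms(2) 1 by (simp add: farey_def moebius_def add.commute)
  moreover have "of_int 1 * (- farey b n) + of_int 1 \<noteq> 0"
    using False assms(2) 1 by (simp add: farey_def)
  ultimately show ?thesis
    using geodesic_integral_imoebius[of 1 1 0 1 w "- farey b n" z z'] assms False
    by (simp add: farey_imoebius)
qed

lemma geodesic_integral_word:
  assumes "w > 0" "n > 0"
  shows "geodesic_integral (word_act bs w) (- n) rho2 (word_act bs rho2)
       = (\<Sum>(x, m)\<leftarrow>orbit bs w n. arc_term x m)"
  using assms(2)
proof (induction bs arbitrary: n)
  case Nil
  show ?case by (simp add: geodesic_integral_def)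
next
  case (Cons b bs)
  have up: "word_act bs rho2 \<in> upper_half_plane"
    using word_act_upper_half_plane rho_upper by blast
  have "geodesic_integral (word_act (b # bs) w) (- n) rho2 (word_act (b # bs) rho2)
      = geodesic_integral (word_act (b # bs) w) (- n) rho2 (farey b rho2)
        + geodesic_integral (farey b (word_act bs w)) (- n) (farey b rho2) (farey b (word_act bs rho2))"
    using geodesic_integral_join[of rho2 "farey b rho2" "farey b (word_act bs rho2)"]
      farey_upper_half_plane[OF up, of b] farey_upper_half_plane[OF rho_upper(2), of b] rho_upper
    by (simp del: in_upper_half_plane)
  also have "\<dots> = arc_term (word_act (b # bs) w) n + geodesic_integral (word_act bs w) (- farey b n) rho2 (word_act bs rho2)"
    unfolding geodesic_integral_farey[OF word_act_pos[OF assms(1)] Cons.prems rho_upper(2) up]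
    by (simp add: farey_rho2 arc_term_def)
  also have "\<dots> = (\<Sum>(x, m)\<leftarrow>orbit (b # bs) w n. arc_term x m)"
    using Cons.IH[OF farey_pos[OF Cons.prems]] by simp
  finally show ?case .
qed

end

context modular_real_on_arc
begin

lemma Re_sum_arc_has_integral:
  assumes "\<And>x m. (x, m) \<in> set xs \<Longrightarrow> x > 0 \<and> m > 0"
  shows "((\<lambda>t. Re (f (cis t)) * (\<Sum>s\<leftarrow>orbit_traces xs. arc_kernel s t)) has_integral
      Re (\<Sum>(x, m)\<leftarrow>xs. arc_term x m)) arc_range"
  using assms
proof (induction xs)
  case (Cons xm xs)
  obtain x m where xm: "xm = (x, m)" by (cases xm)
  then have "x > 0" "m > 0" using Cons.prems[of x m] by auto
  then have "((\<lambda>t. Re (f (cis t)) * (arc_kernel (inv_sum x) t + arc_kernel (inv_sum m) t)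
        + Re (f (cis t)) * (\<Sum>s\<leftarrow>orbit_traces xs. arc_kernel s t)) has_integral
      Re (arc_term x m) + Re (\<Sum>(x, m)\<leftarrow>xs. arc_term x m)) arc_range"
    using Cons.prems by (intro has_integral_add Re_arc_has_integral Cons.IH) auto
  then show ?case
    by (simp add: xm algebra_simps)
qed simp

end

text \<open>Euclidean descent. Determinant 1 and nonnegative entries force one row to dominate the
  other, except for the identity; subtracting the smaller row removes one letter and lowers the sum
  of the entries. The coefficients in the clause on \<open>back_act\<close> come from the inverse
  matrix after changing the sign of argument and value.\<close>

lemma nonneg_matrix_word:
  fixes p q r s :: int
  assumes "p \<ge> 0" "q \<ge> 0" "r \<ge> 0" "s \<ge> 0" "p * s - q * r = 1"
  shows "\<exists>bs. (\<forall>z\<in>upper_half_plane. word_act bs z = imoebius p q r s z)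
      \<and> (\<forall>x>0::real. word_act bs x = imoebius p q r s x)
      \<and> (\<forall>n>0. back_act bs n = imoebius s q r p n)"
  using assms
proof (induction "nat (p + q + r + s)" arbitrary: p q r s rule: less_induct)
  case less
  have det: "p * s = 1 + q * r" using less.prems by simp
  consider (one) "p = 1" "s = 1" "q = 0" "r = 0" | (top) "p \<ge> r" "q \<ge> s" | (bot) "r \<ge> p" "s \<ge> q"
  proof -
    have "p = 1 \<and> s = 1 \<and> q = 0 \<and> r = 0" if "p > r" "s > q"
    proof -
      have "(r + 1) * (q + 1) \<le> p * s" using that less.prems by (intro mult_mono) auto
      then have "r + q \<le> 0" using det by (simp add: algebra_simps)
      then have "r = 0" "q = 0" using less.prems by auto
      then show ?thesis using det less.prems by (simp add: zmult_eq_1_iff)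
    qed
    moreover have False if "p < r" "q > s"
    proof -
      have "p * s \<le> r * q" using that less.prems by (intro mult_mono) auto
      then show ?thesis using det by (simp add: mult.commute)
    qed
    moreover consider "p > r" "s > q" | "p < r" "q > s" | "p \<ge> r" "q \<ge> s" | "r \<ge> p" "s \<ge> q"
      by linarith
    ultimately show ?thesis using that by cases auto
  qed
  then show ?case
  proof cases
    case one
    then show ?thesis by (intro exI[of _ "[]"]) (simp add: moebius_def)
  next
    case top
    have "r \<noteq> 0 \<or> s \<noteq> 0" using det by auto
    then have rs: "r + s > 0" using less.prems by linarith
    have det': "(p - r) * s - (q - s) * r = 1" using less.prems by (simp add: algebra_simps)
    have "nat (p - r + (q - s) + r + s) < nat (p + q + r + s)" using rs less.prems top by auto
    from less.hyps[OF this _ _ _ _ det'] top less.prems obtain bs where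
      bs: "\<forall>z\<in>upper_half_plane. word_act bs z = imoebius (p - r) (q - s) r s z"
        "\<forall>x>0::real. word_act bs x = imoebius (p - r) (q - s) r s x"
        "\<forall>n>0. back_act bs n = imoebius s (q - s) r (p - r) n" by auto
    have step: "imoebius (p - r) (q - s) r s z + 1 = imoebius p q r s z"
      if "of_int r * z + of_int s \<noteq> 0" for z :: "'a::field"
      using that by (simp add: moebius_def divide_simps) (simp add: algebra_simps)
    have "word_act (True # bs) z = imoebius p q r s z" if "z \<in> upper_half_plane" for z
      using bs(1) that step[OF moebius_denom_nonzero[OF that less.prems(5)]] by (simp add: farey_def)
    moreover have "word_act (True # bs) x = imoebius p q r s x" if "x > 0" for x :: real
    proof -
      have "of_int r * x + of_int s \<noteq> 0"
        using rs less.prems that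
        by (smt (verit, best) mult_nonneg_nonneg mult_pos_pos of_int_0_le_iff of_int_0_less_iff)
      with bs(2) that step show ?thesis by (simp add: farey_def)
    qed
    moreover have "back_act (True # bs) n = imoebius s q r p n" if "n > 0" for n
      using bs(3) that by (simp add: farey_def moebius_def algebra_simps)
    ultimately show ?thesis by blast
  next
    case bot
    have "p \<noteq> 0 \<or> q \<noteq> 0" using det by auto
    then have pq: "p + q > 0" using less.prems by linarith
    have det': "p * (s - q) - q * (r - p) = 1" using less.prems by (simp add: algebra_simps)
    have "nat (p + q + (r - p) + (s - q)) < nat (p + q + r + s)" using pq less.prems bot by auto
    from less.hyps[OF this _ _ _ _ det'] bot less.prems obtain bs where
      bs: "\<forall>z\<in>upper_half_plane. word_act bs z = imoebius p q (r - p) (s - q) z"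
        "\<forall>x>0::real. word_act bs x = imoebius p q (r - p) (s - q) x"
        "\<forall>n>0. back_act bs n = imoebius (s - q) q (r - p) p n" by auto
    have step: "farey False (imoebius p q (r - p) (s - q) z) = imoebius p q r s z"
      if "of_int (r - p) * z + of_int (s - q) \<noteq> 0" "of_int r * z + of_int s \<noteq> 0" for z :: "'a::field"
    proof -
      have "imoebius p q (r - p) (s - q) z + 1 = (of_int r * z + of_int s) / (of_int (r - p) * z + of_int (s - q))"
        using that(1) by (simp add: moebius_def divide_simps) (simp add: algebra_simps)
      then show ?thesis using that by (simp add: farey_def moebius_def)
    qed
    have "word_act (False # bs) z = imoebius p q r s z" if "z \<in> upper_half_plane" for z
      using bs(1) that step[OF moebius_denom_nonzero[OF that det'] moebius_denom_nonzero[OF that less.prems(5)]]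
      by simp
    moreover have "word_act (False # bs) x = imoebius p q r s x" if "x > 0" for x :: real
    proof -
      have pos: "of_int a * x + of_int b > 0" if "a \<ge> 0" "b \<ge> 0" "a \<noteq> 0 \<or> b \<noteq> 0" for a b :: int
        using that \<open>x > 0\<close> by (smt (verit, best) mult_nonneg_nonneg mult_pos_pos of_int_0_le_iff of_int_0_less_iff)
      have "r - p \<noteq> 0 \<or> s - q \<noteq> 0" "r \<noteq> 0 \<or> s \<noteq> 0"
        using det det' by auto
      then have "of_int (r - p) * x + of_int (s - q) > 0" "of_int r * x + of_int s > 0"
        using bot less.prems by (intro pos; simp)+
      with bs(2) that step[of x] show ?thesis by simp
    qed
    moreover have "back_act (False # bs) n = imoebius s q r p n" if "n > 0" for n
    proof -
      have "imoebius (s - q) q (r - p) p (n / (n + 1))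
         = ((of_int (s - q) * n + of_int q * (n + 1)) / (n + 1)) / ((of_int (r - p) * n + of_int p * (n + 1)) / (n + 1))"
        using that by (simp add: moebius_def add_divide_distrib)
      also have "of_int (s - q) * n + of_int q * (n + 1) = of_int s * n + of_int q"
        by (simp add: algebra_simps)
      also have "of_int (r - p) * n + of_int p * (n + 1) = of_int r * n + of_int p"
        by (simp add: algebra_simps)
      also have "(of_int s * n + of_int q) / (n + 1) / ((of_int r * n + of_int p) / (n + 1)) = imoebius s q r p n"
        using that by (simp add: moebius_def)
      finally show ?thesis using bs(3) that by (simp add: farey_def)
    qed
    ultimately show ?thesis by blast
  qed
qed

section \<open>Pell equation and separation of irrationals\<close>

text \<open>The error of such an approximation, multiplied by the squared denominator, is at most 1.
  This makes the bound on the norm independent of h and k, as the pigeonhole argument for Pell's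
  equation requires.\<close>

lemma approx_set_norm_bound:
  assumes "(h, k) \<in> approx_set (sqrt (real_of_int D))" "D \<ge> 0"
  shows "\<bar>h\<^sup>2 - D * k\<^sup>2\<bar> \<le> \<lceil>2 * sqrt (real_of_int D) + 1\<rceil>"
proof -
  define \<theta> where "\<theta> = sqrt (real_of_int D)"
  define x where "x = real_of_int k"
  define y where "y = real_of_int h"
  define e where "e = \<theta> - y / x"
  have \<theta>: "\<theta> \<ge> 0" "\<theta>\<^sup>2 = of_int D"
    using assms(2) by (auto simp: \<theta>_def)
  have x: "x \<ge> 1" and e: "\<bar>e\<bar> < 1 / x\<^sup>2"
    using assms(1) by (auto simp: approx_set_def \<theta>_def x_def y_def e_def)
  have e1: "x\<^sup>2 * \<bar>e\<bar> \<le> 1"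
    using e x by (simp add: field_simps)
  have "1 \<le> x\<^sup>2" using x by simp
  then have e2: "\<bar>e\<bar> \<le> 1"
    using e1 mult_right_mono[of 1 "x\<^sup>2" "\<bar>e\<bar>"] by simp
  have y: "y = x * (\<theta> - e)"
    using x by (simp add: e_def)
  have "y\<^sup>2 - \<theta>\<^sup>2 * x\<^sup>2 = x\<^sup>2 * e * (e - 2 * \<theta>)"
    unfolding y by (simp add: power2_eq_square algebra_simps)
  then have "\<bar>y\<^sup>2 - \<theta>\<^sup>2 * x\<^sup>2\<bar> = (x\<^sup>2 * \<bar>e\<bar>) * \<bar>e - 2 * \<theta>\<bar>"
    by (simp add: abs_mult)
  also have "\<dots> \<le> 1 * (2 * \<theta> + 1)"
    using e1 e2 \<theta>(1) by (intro mult_mono) auto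
  finally have "of_int \<bar>h\<^sup>2 - D * k\<^sup>2\<bar> \<le> 2 * \<theta> + 1"
    by (simp add: \<theta>(2) x_def y_def)
  also have "\<dots> \<le> of_int \<lceil>2 * \<theta> + 1\<rceil>"
    by (rule le_of_int_ceiling)
  finally show ?thesis
    unfolding \<theta>_def by (simp only: of_int_le_iff)
qed

text \<open>Dirichlet's argument: among infinitely many good approximations, two distinct ones share
  the norm N and the residues modulo N, and their quotient is an integral element of norm 1. It is
  not trivial, because distinct reduced fractions are not proportional.\<close>

lemma pell_solution_exists:
  fixes D :: int
  assumes "D \<ge> 0" "sqrt (real_of_int D) \<notin> \<rat>"
  shows "\<exists>t u. t\<^sup>2 - D * u\<^sup>2 = 1 \<and> t > 1"
proof -
  let ?S = "approx_set (sqrt (real_of_int D))"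
  let ?N = "\<lambda>(h, k). h\<^sup>2 - D * k\<^sup>2"
  let ?g = "\<lambda>x. (?N x, fst x mod ?N x, snd x mod ?N x)"
  let ?B = "\<lceil>2 * sqrt (real_of_int D) + 1\<rceil>"
  have inf: "infinite ?S" using assms(2) rational_iff_finite_approx_set by blast
  have N0: "?N x \<noteq> 0" if "x \<in> ?S" for x
  proof
    assume 0: "?N x = 0"
    obtain h k where x: "x = (h, k)" "k > 0" using \<open>x \<in> ?S\<close> by (auto simp: approx_set_def)
    then have "h\<^sup>2 = D * k\<^sup>2" using 0 by simp
    then have "real_of_int D = (of_int h / of_int k)\<^sup>2"
      using x(2) by (simp add: power_divide field_simps) (metis of_int_mult of_int_power)
    then have "sqrt (real_of_int D) = \<bar>of_int h / of_int k\<bar>" by simp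
    then show False using assms(2) by (auto intro!: Rats_abs_iff[THEN iffD2])
  qed
  have "?g ` ?S \<subseteq> {- ?B..?B} \<times> {- ?B..?B} \<times> {- ?B..?B}"
  proof (intro image_subsetI)
    fix x assume x: "x \<in> ?S"
    obtain h k where hk: "x = (h, k)" by (cases x)
    have b: "\<bar>?N x\<bar> \<le> ?B" using approx_set_norm_bound x hk assms(1) by auto
    have "\<bar>c mod ?N x\<bar> \<le> ?B" for c
      using abs_mod_less[OF N0[OF x], of c] b by simp
    with b show "?g x \<in> {- ?B..?B} \<times> {- ?B..?B} \<times> {- ?B..?B}"
      unfolding mem_Times_iff fst_conv snd_conv atLeastAtMost_iff abs_le_iff by (simp only: minus_le_iff)
  qed
  then have "finite (?g ` ?S)" by (rule finite_subset) auto
  from pigeonhole_infinite[OF inf this] obtain x where x: "x \<in> ?S" and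
    inf': "infinite {y \<in> ?S. ?g y = ?g x}" by blast
  then obtain y where y: "y \<in> ?S" "?g y = ?g x" "y \<noteq> x"
    using infinite_imp_nonempty[OF infinite_remove[OF inf', of x]] by blast
  obtain h k where hk: "x = (h, k)" "k > 0" "coprime h k" using x by (auto simp: approx_set_def)
  obtain h' k' where hk': "y = (h', k')" "k' > 0" "coprime h' k'" using y(1) by (auto simp: approx_set_def)
  define N where "N = h\<^sup>2 - D * k\<^sup>2"
  have N: "N \<noteq> 0" "h'\<^sup>2 - D * k'\<^sup>2 = N" "h' mod N = h mod N" "k' mod N = k mod N"
    using N0[OF x] y(2) by (auto simp: N_def hk hk')
  obtain i where i: "h' = h + N * i"
    using N(3) by (metis mod_eqE mult.commute)
  obtain j where j: "k' = k + N * j"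
    using N(4) by (metis mod_eqE mult.commute)
  \<comment> \<open>t and u are the coefficients of (h - k sqrt D) (h' + k' sqrt D) / N; the
    congruences modulo N make them integers.\<close>
  define t where "t = 1 + h * i - D * k * j"
  define u where "u = h * j - i * k"
  have tN: "h * h' - D * k * k' = N * t"
    by (simp add: t_def N_def i j power2_eq_square algebra_simps)
  have uN: "h * k' - h' * k = N * u"
    by (simp add: u_def i j algebra_simps)
  have "(h * h' - D * k * k')\<^sup>2 - D * (h * k' - h' * k)\<^sup>2 = (h\<^sup>2 - D * k\<^sup>2) * (h'\<^sup>2 - D * k'\<^sup>2)"
    by (simp add: power2_eq_square algebra_simps)
  then have "N\<^sup>2 * (t\<^sup>2 - D * u\<^sup>2) = N\<^sup>2 * 1"
    unfolding tN uN N(2) N_def[symmetric] by (simp add: power2_eq_square algebra_simps)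
  then have tu: "t\<^sup>2 - D * u\<^sup>2 = 1" using N(1) by simp
  have "u \<noteq> 0"
  proof
    assume "u = 0"
    then have eq: "h * k' = h' * k" using uN by simp
    then have "k dvd k'" "k' dvd k"
      using hk(3) hk'(3) by (metis coprime_commute coprime_dvd_mult_right_iff dvd_triv_right)+
    then have "k = k'" using hk(2) hk'(2) by (simp add: zdvd_antisym_nonneg)
    with eq hk(2) have "h = h'" by simp
    with \<open>k = k'\<close> y(3) show False by (simp add: hk hk')
  qed
  moreover have "D \<noteq> 0" using assms(2) by auto
  ultimately have "D * u\<^sup>2 > 0" using assms(1) by simp
  then have "\<bar>t\<bar>\<^sup>2 > 1\<^sup>2" using tu by simp
  then have "\<bar>t\<bar> > 1" by (rule power2_less_imp_less) simp
  with tu show ?thesis by (intro exI[of _ "\<bar>t\<bar>"] exI[of _ u]) simp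
qed

text \<open>The matrix with rows (h, x) and (k, y) sends infinity to h / k and 0 to x / y. Hence the
  preimages of a and b have opposite signs exactly when one of these two fractions, but not the
  other, lies between a and b.\<close>

lemma unimodular_separation_ordered:
  fixes a b :: real
  assumes "a < b" "a \<notin> \<rat>" "b \<notin> \<rat>"
  shows "\<exists>h x k y :: int. h * y - x * k = 1 \<and>
    ((of_int y * a - of_int x) / (of_int h - of_int k * a)) * ((of_int y * b - of_int x) / (of_int h - of_int k * b)) < 0"
proof -
  define P where "P k \<longleftrightarrow> k > 0 \<and> (\<exists>h::int. a < of_int h / real k \<and> of_int h / real k < b)" for k :: nat
  obtain c where c: "c \<in> \<rat>" "a < c" "c < b" using Rats_dense_in_real[OF assms(1)] by blast
  then obtain h0 k0 where "c = of_int h0 / of_int k0" "k0 > 0" by (meson Rats_cases')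
  then have "P (nat k0)" using c by (auto simp: P_def)
  then have least: "P (LEAST k. P k)" "\<And>j. P j \<Longrightarrow> (LEAST k. P k) \<le> j"
    by (auto intro: LeastI Least_le)
  \<comment> \<open>The Bezout neighbour of a fraction of least denominator in \<open>(a, b)\<close> lies outside \<open>(a, b)\<close>.\<close>
  define K where "K = (LEAST k. P k)"
  define k where "k = int K"
  obtain h :: int where h: "a < of_int h / of_int k" "of_int h / of_int k < b" and k: "k > 0"
    using least(1) by (auto simp: P_def K_def k_def)
  have min: "j \<ge> k" if "j > 0" "a < of_int g / of_int j" "of_int g / of_int j < b" for j g :: int
  proof -
    have "P (nat j)" using that by (auto simp: P_def)
    then have "K \<le> nat j" unfolding K_def by (rule least(2))
    then show ?thesis using that(1) by (simp add: k_def)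
  qed
  have "coprime h k"
  proof -
    have "gcd h k \<noteq> 0" using k by simp
    from gcd_coprime_exists[OF this] obtain d e where de: "h = gcd h k * d" "k = gcd h k * e"
      by (metis mult.commute)
    have g: "gcd h k > 0" using k by simp
    have e: "e > 0" using de(2) k g by (metis zero_less_mult_pos)
    have "of_int h / of_int k = (of_int (gcd h k) * of_int d) / (of_int (gcd h k) * real_of_int e)"
      using de(1,2) by (metis of_int_mult)
    also have "\<dots> = of_int d / of_int e"
      using g by (intro mult_divide_mult_cancel_left) (simp only: of_int_eq_0_iff)
    finally have "k \<le> e" using min[OF e] h by simp
    then have "gcd h k * e \<le> e" using de(2) by simp
    then have "gcd h k \<le> 1" using e by simp
    with g have "gcd h k = 1" by linarith
    then show ?thesis by (simp add: coprime_iff_gcd_eq_1)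
  qed
  then obtain u v where uv: "u * h + v * k = 1"
    using bezout_int[of h k] by auto
  \<comment> \<open>Reduction modulo k gives the neighbour a denominator below the minimal one; y =
    0 means that the neighbour is infinity.\<close>
  define y where "y = u mod k"
  define x where "x = - (v + (u div k) * h)"
  have u: "u = y + k * (u div k)" by (simp add: y_def)
  have det: "h * y - x * k = 1"
  proof -
    have "(y + k * (u div k)) * h + v * k = 1" using uv u by simp
    then show ?thesis by (simp add: x_def algebra_simps)
  qed
  have y: "0 \<le> y" "y < k" using k by (auto simp: y_def)
  have ha: "of_int h - of_int k * a > 0" and hb: "of_int h - of_int k * b < 0"
    using h k by (auto simp: field_simps)
  have same: "(of_int y * a - of_int x) * (of_int y * b - of_int x) > 0"
  proof (cases "y = 0")
    case True
    then have "x \<noteq> 0" using det by auto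
    with True show ?thesis by (auto simp: zero_less_mult_iff)
  next
    case False
    with y have y0: "y > 0" by simp
    have "\<not> (a < of_int x / of_int y \<and> of_int x / of_int y < b)"
      using min[OF y0, of x] y(2) by auto
    moreover have "of_int x / of_int y \<noteq> a" "of_int x / of_int y \<noteq> b"
      using assms by auto
    ultimately have "of_int x / of_int y < a \<or> b < of_int x / of_int y" by linarith
    then show ?thesis
    proof
      assume "of_int x / of_int y < a"
      moreover from this have "of_int x / of_int y < b" using assms(1) by simp
      ultimately show ?thesis using y0 by (intro mult_pos_pos) (simp_all add: field_simps)
    next
      assume "b < of_int x / of_int y"
      moreover from this have "a < of_int x / of_int y" using assms(1) by simp
      ultimately show ?thesis using y0 by (intro mult_neg_neg) (simp_all add: field_simps)
    qed
  qed
  have "((of_int y * a - of_int x) / (of_int h - of_int k * a)) * ((of_int y * b - of_int x) / (of_int h - of_int k * b))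
      = ((of_int y * a - of_int x) * (of_int y * b - of_int x)) / ((of_int h - of_int k * a) * (of_int h - of_int k * b))"
    by simp
  also have "\<dots> < 0"
    using same mult_pos_neg[OF ha hb] by (rule divide_pos_neg)
  finally show ?thesis using det by blast
qed

lemma unimodular_separation:
  fixes a b :: real
  assumes "a \<noteq> b" "a \<notin> \<rat>" "b \<notin> \<rat>"
  shows "\<exists>h x k y :: int. h * y - x * k = 1 \<and>
    (of_int y * a - of_int x) / (of_int h - of_int k * a) > 0 \<and> (of_int y * b - of_int x) / (of_int h - of_int k * b) < 0"
proof -
  have "\<exists>h x k y :: int. h * y - x * k = 1 \<and>
    ((of_int y * a - of_int x) / (of_int h - of_int k * a)) * ((of_int y * b - of_int x) / (of_int h - of_int k * b)) < 0"
  proof (cases "a < b")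
    case True
    then show ?thesis using unimodular_separation_ordered assms by blast
  next
    case False
    then have "b < a" using assms by simp
    from unimodular_separation_ordered[OF this assms(3,2)] show ?thesis
      by (subst (asm) mult.commute)
  qed
  then obtain h x k y :: int where det: "h * y - x * k = 1" and
    neg: "((of_int y * a - of_int x) / (of_int h - of_int k * a)) * ((of_int y * b - of_int x) / (of_int h - of_int k * b)) < 0"
    by blast
  show ?thesis
  proof (cases "(of_int y * a - of_int x) / (of_int h - of_int k * a) > 0")
    case True
    then have "(of_int y * b - of_int x) / (of_int h - of_int k * b) < 0"
      using neg by (meson mult_nonneg_nonneg less_imp_le not_less)
    with True det show ?thesis by blast
  next
    case False
    \<comment> \<open>If the signs come in the wrong order, a further z -> - 1 / z exchanges
      them.\<close>
    have flip: "(of_int (- k) * c - of_int (- h)) / (of_int x - of_int y * c)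
        = - inverse ((of_int y * c - of_int x) / (of_int h - of_int k * c))" for c :: real
    proof -
      have "of_int x - of_int y * c = - (of_int y * c - of_int x)" by simp
      then show ?thesis by (simp only: divide_minus_right) simp
    qed
    from False neg have "(of_int y * a - of_int x) / (of_int h - of_int k * a) < 0"
      "(of_int y * b - of_int x) / (of_int h - of_int k * b) > 0"
      unfolding mult_less_0_iff by linarith+
    then have "- inverse ((of_int y * a - of_int x) / (of_int h - of_int k * a)) > 0"
      "- inverse ((of_int y * b - of_int x) / (of_int h - of_int k * b)) < 0"
      by (simp_all only: neg_0_less_iff_less neg_less_0_iff_less inverse_negative_iff_negative inverse_positive_iff_positive)
    then have "(of_int (- k) * a - of_int (- h)) / (of_int x - of_int y * a) > 0"
      "(of_int (- k) * b - of_int (- h)) / (of_int x - of_int y * b) < 0"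
      unfolding flip .
    moreover have "x * (- k) - (- h) * y = 1" using det by (simp add: algebra_simps)
    ultimately show ?thesis by blast
  qed
qed

section \<open>Hyperbolic matrices as words\<close>

text \<open>\<open>(x, 1)\<close> is an eigenvector of the matrix with rows \<open>(p, q)\<close> and \<open>(r, s)\<close>.\<close>

definition eigen :: "int \<Rightarrow> int \<Rightarrow> int \<Rightarrow> int \<Rightarrow> real \<Rightarrow> real \<Rightarrow> bool" where
  "eigen p q r s x l \<longleftrightarrow> of_int p * x + of_int q = l * x \<and> of_int r * x + of_int s = l"

lemma eigen_imoebius: "eigen p q r s x l \<Longrightarrow> l \<noteq> 0 \<Longrightarrow> imoebius p q r s x = x"
  by (simp add: eigen_def moebius_def)

lemma hyperbolic_eigen_exists:
  assumes det: "p * s - q * r = 1" and tr: "\<bar>p + s\<bar> > 2"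
  shows "r \<noteq> 0" "\<exists>a b l. \<bar>l\<bar> > 1 \<and> eigen p q r s a l \<and> eigen p q r s b (1 / l)"
proof -
  show r: "r \<noteq> 0"
  proof
    assume "r = 0"
    then have "p * s = 1" using det by simp
    then show False using tr by (auto simp: zmult_eq_1_iff)
  qed
  define t where "t = real_of_int (p + s)"
  have t: "\<bar>t\<bar> > 2" using tr unfolding t_def by linarith
  have det': "of_int p * of_int s - of_int q * of_int r = (1::real)"
    using det by (metis of_int_1 of_int_diff of_int_mult)
  have "\<bar>t\<bar>\<^sup>2 > 2\<^sup>2" using t by (intro power_strict_mono) auto
  then have t4: "t\<^sup>2 - 4 > 0" by simp
  \<comment> \<open>Giving the root the sign of the trace selects the eigenvalue of larger absolute
    value; the trace may be negative.\<close>
  define l where "l = (t + sgn t * sqrt (t\<^sup>2 - 4)) / 2"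
  have sq: "(sgn t * sqrt (t\<^sup>2 - 4))\<^sup>2 = t\<^sup>2 - 4"
    using t4 t by (simp add: power_mult_distrib) (auto simp: sgn_if)
  have l: "l\<^sup>2 = t * l - 1"
  proof -
    have "2 * l - t = sgn t * sqrt (t\<^sup>2 - 4)" by (simp add: l_def field_simps)
    then have "(2 * l - t)\<^sup>2 = t\<^sup>2 - 4" by (simp only: sq)
    then show ?thesis by (simp add: power2_eq_square algebra_simps)
  qed
  have l1: "\<bar>l\<bar> > 1"
  proof -
    have "\<bar>t + sgn t * c\<bar> > 2" if "c \<ge> 0" for c
      using t that by (cases "t > 0") (auto simp: sgn_if)
    then have "\<bar>t + sgn t * sqrt (t\<^sup>2 - 4)\<bar> > 2"
      using t4 by simp
    then show ?thesis by (simp add: l_def)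
  qed
  have fixed: "eigen p q r s ((m - of_int s) / of_int r) m" if "m\<^sup>2 = t * m - 1" for m
  proof -
    have "(of_int p - m) * (m - of_int s) + of_int q * of_int r = 0"
      using that det' by (simp add: t_def power2_eq_square algebra_simps)
    then have "(of_int p - m) * ((m - of_int s) / of_int r) + of_int q = 0"
      using r by (simp add: field_simps)
    then have "of_int p * ((m - of_int s) / of_int r) + of_int q = m * ((m - of_int s) / of_int r)"
      unfolding left_diff_distrib by linarith
    then show ?thesis
      using r by (simp add: eigen_def)
  qed
  have "(1 / l)\<^sup>2 = t * (1 / l) - 1"
  proof -
    have "1 = t * l - l\<^sup>2" using l by simp
    then have "1 / l\<^sup>2 = (t * l - l\<^sup>2) / l\<^sup>2" by simp
    also have "\<dots> = t * (1 / l) - 1" using l1 by (auto simp: field_simps power2_eq_square)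
    finally show ?thesis by (simp add: power_divide)
  qed
  with fixed l l1 show "\<exists>a b l. \<bar>l\<bar> > 1 \<and> eigen p q r s a l \<and> eigen p q r s b (1 / l)" by blast
qed

lemma eigen_distinct: "eigen p q r s a l \<Longrightarrow> eigen p q r s b (1 / l) \<Longrightarrow> \<bar>l\<bar> > 1 \<Longrightarrow> a \<noteq> b"
proof
  assume "eigen p q r s a l" "eigen p q r s b (1 / l)" "\<bar>l\<bar> > 1" "a = b"
  then have "l * l = 1" by (auto simp: eigen_def field_simps)
  then have "l = 1 \<or> l = - 1" by (simp add: square_eq_1_iff)
  with \<open>\<bar>l\<bar> > 1\<close> show False by auto
qed

text \<open>The four long entries are those of g^-1 A g, where A has rows (p, q) and (r, s) and g
  has rows (h, x) and (k, y). The proof works with the vector (d a', d) = g^-1 (a, 1), which avoids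
  fractions.\<close>

lemma eigen_conjugate:
  fixes h x k y :: int
  assumes "eigen p q r s a l" "h * y - x * k = 1" "of_int h - of_int k * a \<noteq> 0"
  defines "a' \<equiv> (of_int y * a - of_int x) / (of_int h - of_int k * a)"
  shows "eigen (y * (p * h + q * k) - x * (r * h + s * k)) (y * (p * x + q * y) - x * (r * x + s * y))
    (h * (r * h + s * k) - k * (p * h + q * k)) (h * (r * x + s * y) - k * (p * x + q * y)) a' l"
    and "of_int k * a' + of_int y \<noteq> 0" and "imoebius h x k y a' = a"
proof -
  define d where "d = of_int h - of_int k * a"
  have d: "d \<noteq> 0" using assms(3) by (simp add: d_def)
  have da: "d * a' = of_int y * a - of_int x"
    using d unfolding a'_def d_def[symmetric] by simp
  have det: "of_int h * of_int y - of_int x * of_int k = (1::real)"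
    using assms(2) by (metis of_int_1 of_int_diff of_int_mult)
  have e1: "of_int p * a + of_int q = l * a" and e2: "of_int r * a + of_int s = l"
    using assms(1) by (auto simp: eigen_def)
  have u: "of_int h * (d * a') + of_int x * d = a"
    unfolding da using det by (simp only: d_def) algebra
  have v: "of_int k * (d * a') + of_int y * d = 1"
    unfolding da using det by (simp only: d_def) algebra
  have 1: "of_int (y * (p * h + q * k) - x * (r * h + s * k)) * (d * a') + of_int (y * (p * x + q * y) - x * (r * x + s * y)) * d
      = of_int y * (of_int p * (of_int h * (d * a') + of_int x * d) + of_int q * (of_int k * (d * a') + of_int y * d))
        - of_int x * (of_int r * (of_int h * (d * a') + of_int x * d) + of_int s * (of_int k * (d * a') + of_int y * d))"
    by (simp add: algebra_simps)
  have 2: "of_int (h * (r * h + s * k) - k * (p * h + q * k)) * (d * a') + of_int (h * (r * x + s * y) - k * (p * x + q * y)) * d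
      = of_int h * (of_int r * (of_int h * (d * a') + of_int x * d) + of_int s * (of_int k * (d * a') + of_int y * d))
        - of_int k * (of_int p * (of_int h * (d * a') + of_int x * d) + of_int q * (of_int k * (d * a') + of_int y * d))"
    by (simp add: algebra_simps)
  have expand: "d * (P * a' + Q) = P * (d * a') + Q * d" for P Q
    by (simp add: algebra_simps)
  have "d * (of_int (y * (p * h + q * k) - x * (r * h + s * k)) * a' + of_int (y * (p * x + q * y) - x * (r * x + s * y))) = d * (l * a')"
    unfolding expand 1 u v mult_1_right e1 e2 using da by algebra
  moreover have "d * (of_int (h * (r * h + s * k) - k * (p * h + q * k)) * a' + of_int (h * (r * x + s * y) - k * (p * x + q * y))) = d * l"
    unfolding expand 2 u v mult_1_right e1 e2 by (simp add: d_def algebra_simps)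
  ultimately show "eigen (y * (p * h + q * k) - x * (r * h + s * k)) (y * (p * x + q * y) - x * (r * x + s * y))
    (h * (r * h + s * k) - k * (p * h + q * k)) (h * (r * x + s * y) - k * (p * x + q * y)) a' l"
    unfolding eigen_def using d by simp
  have v': "d * (of_int k * a' + of_int y) = 1" using v by (simp add: algebra_simps)
  then show nz: "of_int k * a' + of_int y \<noteq> 0" by auto
  have u': "d * (of_int h * a' + of_int x) = a" using u by (simp add: algebra_simps)
  have "imoebius h x k y a' = (d * (of_int h * a' + of_int x)) / (d * (of_int k * a' + of_int y))"
    using d by (simp add: moebius_def)
  also have "\<dots> = a" unfolding u' v' by simp
  finally show "imoebius h x k y a' = a" .
qed

text \<open>For l > 1 and b < 0 < a, solving the eigenvector equations for the entries, each
  multiplied by a - b, shows that all are nonnegative, so the matrix is a word. A negative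
  eigenvalue is removed by negating the matrix, which leaves the action unchanged.\<close>

lemma eigen_word:
  assumes det: "p * s - q * r = 1" and e: "eigen p q r s a l" "eigen p q r s b (1 / l)" "\<bar>l\<bar> > 1"
    and ab: "a > 0" "b < 0"
  shows "\<exists>bs. (\<forall>z\<in>upper_half_plane. word_act bs z = imoebius p q r s z) \<and> word_act bs a = a \<and> back_act bs (- b) = - b"
proof -
  have main: "\<exists>bs. (\<forall>z\<in>upper_half_plane. word_act bs z = imoebius p q r s z) \<and> word_act bs a = a \<and> back_act bs (- b) = - b"
    if det: "p * s - q * r = 1" and e: "eigen p q r s a l" "eigen p q r s b (1 / l)" and l: "l > 1" for p q r s l
  proof -
    define m where "m = 1 / l"
    have m: "0 < m" "m < 1" using l by (auto simp: m_def)
    have E: "of_int p * a + of_int q = l * a" "of_int r * a + of_int s = l"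
      "of_int p * b + of_int q = m * b" "of_int r * b + of_int s = m"
      using e by (auto simp: eigen_def m_def)
    have pab: "of_int p * (a - b) = l * a - m * b" and rab: "of_int r * (a - b) = l - m"
      using E by (simp_all add: algebra_simps)
    have sab: "of_int s * (a - b) = m * a - l * b" and qab: "of_int q * (a - b) = - (a * b) * (l - m)"
      using E by algebra+
    have d: "a - b > 0" using ab by simp
    have pos: "c \<ge> 0" if "of_int c * (a - b) > 0" for c :: int
      using that d by (simp add: zero_less_mult_iff)
    have "l * a > 0" "m * b < 0" "m * a > 0" "l * b < 0" "a * b < 0"
      using ab l m by (auto intro: mult_pos_neg mult_pos_pos)
    then have "p \<ge> 0" "q \<ge> 0" "r \<ge> 0" "s \<ge> 0"
      using l m by (auto intro!: pos simp: pab qab rab sab mult_neg_pos)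
    from nonneg_matrix_word[OF this det] obtain bs where
      bs: "\<forall>z\<in>upper_half_plane. word_act bs z = imoebius p q r s z"
        "\<forall>x>0::real. word_act bs x = imoebius p q r s x" "\<forall>n>0. back_act bs n = imoebius s q r p n"
      by blast
    have "word_act bs a = a" using bs(2) ab(1) eigen_imoebius[OF e(1)] l by simp
    moreover have "back_act bs (- b) = - b"
    proof -
      have "of_int p * (a - b) + of_int s * (a - b) = (l + m) * (a - b)"
        using pab sab by (simp add: algebra_simps)
      then have tr: "of_int p + of_int s = l + m"
        using d by (simp add: distrib_right[symmetric])
      have "of_int r * (- b) + of_int p = l" using E(4) tr by simp
      moreover have "of_int s * (- b) + of_int q = l * (- b)" using E(3) tr by algebra
      ultimately have "imoebius s q r p (- b) = - b" using l by (simp add: moebius_def)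
      then show ?thesis using bs(3) ab(2) by simp
    qed
    ultimately show ?thesis using bs(1) by blast
  qed
  show ?thesis
  proof (cases "l > 0")
    case True
    then show ?thesis using main[OF det e(1,2)] e(3) by simp
  next
    case False
    have "eigen (- p) (- q) (- r) (- s) a (- l)" "eigen (- p) (- q) (- r) (- s) b (1 / - l)"
      using e(1,2) by (auto simp: eigen_def)
    moreover have "(- p) * (- s) - (- q) * (- r) = 1" using det by simp
    moreover have "imoebius (- p) (- q) (- r) (- s) z = imoebius p q r s z" for z :: complex
    proof -
      have "imoebius (- p) (- q) (- r) (- s) z = - (of_int p * z + of_int q) / - (of_int r * z + of_int s)"
        by (simp add: moebius_def)
      then show ?thesis by (simp only: moebius_def minus_divide_left[symmetric] divide_minus_right minus_minus)
    qed
    ultimately show ?thesis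
      using main[of "- p" "- s" "- q" "- r" "- l"] False e(3) by simp
  qed
qed

lemma imoebius_compose:
  fixes z :: "'a::field_char_0"
  assumes "of_int r' * z + of_int s' \<noteq> 0"
  shows "imoebius p q r s (imoebius p' q' r' s' z)
    = imoebius (p * p' + q * r') (p * q' + q * s') (r * p' + s * r') (r * q' + s * s') z"
proof -
  define n where "n = of_int p' * z + of_int q'"
  define d where "d = of_int r' * z + of_int s'"
  have d: "d \<noteq> 0" using assms by (simp add: d_def)
  have "imoebius p q r s (imoebius p' q' r' s' z) = (of_int p * (n / d) + of_int q) / (of_int r * (n / d) + of_int s)"
    by (simp add: moebius_def n_def d_def)
  also have "of_int p * (n / d) + of_int q = (of_int p * n + of_int q * d) / d"
    using d by (simp add: field_simps)
  also have "of_int r * (n / d) + of_int s = (of_int r * n + of_int s * d) / d"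
    using d by (simp add: field_simps)
  also have "(of_int p * n + of_int q * d) / d / ((of_int r * n + of_int s * d) / d)
      = (of_int p * n + of_int q * d) / (of_int r * n + of_int s * d)"
    using d by simp
  also have "\<dots> = imoebius (p * p' + q * r') (p * q' + q * s') (r * p' + s * r') (r * q' + s * s') z"
    by (simp add: moebius_def n_def d_def algebra_simps)
  finally show ?thesis .
qed

context modular_invariant
begin

text \<open>Needed because \<open>cycle_integral\<close> starts at an arbitrary point, whereas the
  decomposition into arcs starts at an image of \<open>rho2\<close>.\<close>

lemma geodesic_integral_base:
  assumes det: "p * s - q * r = 1" and e: "eigen p q r s a l" "eigen p q r s b (1 / l)" "l \<noteq> 0"
    and z: "z \<in> upper_half_plane" "z' \<in> upper_half_plane"
  shows "geodesic_integral a b z (imoebius p q r s z) = geodesic_integral a b z' (imoebius p q r s z')"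
proof -
  let ?M = "imoebius p q r s :: complex \<Rightarrow> complex"
  have fixed: "imoebius p q r s a = a" "imoebius p q r s b = b"
    using eigen_imoebius[OF e(1,3)] eigen_imoebius[OF e(2)] e(3) by auto
  have nz: "of_int r * a + of_int s \<noteq> 0" "of_int r * b + of_int s \<noteq> 0"
    using e by (auto simp: eigen_def)
  have M: "?M z \<in> upper_half_plane" "?M z' \<in> upper_half_plane"
    using imoebius_upper_half_plane[OF _ det] z by blast+
  have "geodesic_integral a b z z' = geodesic_integral a b (?M z) (?M z')"
    using geodesic_integral_imoebius[OF det nz z] unfolding fixed by simp
  then show ?thesis
    using geodesic_integral_join[OF z(1) M(1) M(2), of a b] geodesic_integral_join[OF z(1) z(2) M(2), of a b]
    by simp
qed

end

text \<open>The word is chosen before f: the integrals of f and of the constant 1 have to be sums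
  over the same orbit for their quotient to be a weighted mean.\<close>

lemma hyperbolic_word:
  fixes h x k y :: int
  assumes det: "p * s - q * r = 1" and e: "eigen p q r s a l" "eigen p q r s b (1 / l)" "\<bar>l\<bar> > 1"
    and det': "h * y - x * k = 1"
    and pos: "(of_int y * a - of_int x) / (of_int h - of_int k * a) > 0" (is "?a > 0")
    and neg: "(of_int y * b - of_int x) / (of_int h - of_int k * b) < 0" (is "?b < 0")
  shows "\<exists>bs. word_act bs ?a = ?a \<and> back_act bs (- ?b) = - ?b \<and>
    (\<forall>f z. modular_invariant f \<longrightarrow> z \<in> upper_half_plane \<longrightarrow>
      modular_invariant.geodesic_integral f a b z (imoebius p q r s z)
      = (\<Sum>(u, v)\<leftarrow>orbit bs ?a (- ?b). modular_invariant.arc_term f u v))"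
proof -
  define p' where "p' = y * (p * h + q * k) - x * (r * h + s * k)"
  define q' where "q' = y * (p * x + q * y) - x * (r * x + s * y)"
  define r' where "r' = h * (r * h + s * k) - k * (p * h + q * k)"
  define s' where "s' = h * (r * x + s * y) - k * (p * x + q * y)"
  have nza: "of_int h - of_int k * a \<noteq> 0" using pos by (metis div_by_0 less_irrefl)
  have nzb: "of_int h - of_int k * b \<noteq> 0" using neg by (metis div_by_0 less_irrefl)
  note ea = eigen_conjugate[OF e(1) det' nza, folded p'_def q'_def r'_def s'_def]
  note eb = eigen_conjugate[OF e(2) det' nzb, folded p'_def q'_def r'_def s'_def]
  have "p' * s' - q' * r' = (h * y - x * k)\<^sup>2 * (p * s - q * r)"
    by (simp add: p'_def q'_def r'_def s'_def power2_eq_square algebra_simps)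
  then have detB: "p' * s' - q' * r' = 1" using det det' by simp
  from eigen_word[OF detB ea(1) eb(1) e(3) pos neg] obtain bs where
    bs: "\<forall>z\<in>upper_half_plane. word_act bs z = imoebius p' q' r' s' z" "word_act bs ?a = ?a" "back_act bs (- ?b) = - ?b"
    by blast
  have "modular_invariant.geodesic_integral f a b z (imoebius p q r s z)
      = (\<Sum>(u, v)\<leftarrow>orbit bs ?a (- ?b). modular_invariant.arc_term f u v)"
    if "modular_invariant f" and z: "z \<in> upper_half_plane" for f z
  proof -
    interpret modular_invariant f by fact
    let ?g = "imoebius h x k y :: complex \<Rightarrow> complex"
    have g: "?g rho2 \<in> upper_half_plane" using imoebius_upper_half_plane[OF rho_upper(2) det'] .
    have B: "imoebius p' q' r' s' rho2 \<in> upper_half_plane" using imoebius_upper_half_plane[OF rho_upper(2) detB] .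
    have comm: "imoebius p q r s (?g rho2) = ?g (imoebius p' q' r' s' rho2)"
    proof -
      have "h * p' + x * r' = (h * y - x * k) * (p * h + q * k)" "h * q' + x * s' = (h * y - x * k) * (p * x + q * y)"
        "k * p' + y * r' = (h * y - x * k) * (r * h + s * k)" "k * q' + y * s' = (h * y - x * k) * (r * x + s * y)"
        by (simp_all add: p'_def q'_def r'_def s'_def algebra_simps)
      then have "h * p' + x * r' = p * h + q * k" "h * q' + x * s' = p * x + q * y"
        "k * p' + y * r' = r * h + s * k" "k * q' + y * s' = r * x + s * y" using det' by auto
      then show ?thesis
        unfolding imoebius_compose[OF moebius_denom_nonzero[OF rho_upper(2) det']]
          imoebius_compose[OF moebius_denom_nonzero[OF rho_upper(2) detB]] by simp
    qed
    have l0: "l \<noteq> 0" using e(3) by auto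
    have "geodesic_integral a b z (imoebius p q r s z) = geodesic_integral a b (?g rho2) (imoebius p q r s (?g rho2))"
      by (rule geodesic_integral_base[OF det e(1,2) l0 z g])
    also have "\<dots> = geodesic_integral (imoebius h x k y ?a) (imoebius h x k y ?b) (?g rho2) (?g (imoebius p' q' r' s' rho2))"
      unfolding comm ea(3) eb(3) ..
    also have "\<dots> = geodesic_integral ?a ?b rho2 (imoebius p' q' r' s' rho2)"
      by (rule geodesic_integral_imoebius[OF det' ea(2) eb(2) rho_upper(2) B])
    also have "\<dots> = geodesic_integral (word_act bs ?a) (- (- ?b)) rho2 (word_act bs rho2)"
      using bs(1,2) rho_upper(2) by (simp del: in_upper_half_plane)
    also have "\<dots> = (\<Sum>(u, v)\<leftarrow>orbit bs ?a (- ?b). arc_term u v)"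
      using neg by (intro geodesic_integral_word[OF pos]) (simp only: neg_0_less_iff_less)
    finally show ?thesis .
  qed
  with bs(2,3) show ?thesis by blast
qed

section \<open>Cycle integrals\<close>

unbundle no fps_syntax

abbreviation entries_eigen :: "int ^ 2 ^ 2 \<Rightarrow> real \<Rightarrow> real \<Rightarrow> bool" where
  "entries_eigen A \<equiv> eigen (A $ 1 $ 1) (A $ 1 $ 2) (A $ 2 $ 1) (A $ 2 $ 2)"

lemma SL2Z_det: "A \<in> SL2Z \<longleftrightarrow> A $ 1 $ 1 * A $ 2 $ 2 - A $ 1 $ 2 * A $ 2 $ 1 = 1"
  by (simp add: SL2Z_def det_2)

lemma hyperbolic_trace: "hyperbolic A \<longleftrightarrow> \<bar>A $ 1 $ 1 + A $ 2 $ 2\<bar> > 2"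
  by (simp add: hyperbolic_def trace_def UNIV_2)

lemma fixes_point_iff_eigen:
  "fixes_point A x \<longleftrightarrow> (\<exists>l. l \<noteq> 0 \<and> entries_eigen A x l)"
  unfolding fixes_point_def SL2Z_act_def moebius_def eigen_def
  by (metis divide_eq_eq mult.commute)

lemma eigen_quadratic:
  assumes "eigen p q r s x l"
  shows "of_int r * x\<^sup>2 + of_int (s - p) * x - of_int q = 0"
  using assms unfolding eigen_def by (simp add: power2_eq_square) algebra

lemma eigen_vieta:
  assumes "eigen p q r s a l" "eigen p q r s b m" "a \<noteq> b"
  shows "of_int (s - p) = - of_int r * (a + b)" "- of_int q = of_int r * (a * b)"
proof -
  have "(a - b) * (of_int (s - p) + of_int r * (a + b)) = 0"
    using eigen_quadratic[OF assms(1)] eigen_quadratic[OF assms(2)] by algebra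
  then show 1: "of_int (s - p) = - of_int r * (a + b)" using assms(3) by auto
  show "- of_int q = of_int r * (a * b)"
    using eigen_quadratic[OF assms(1)] 1 by algebra
qed

lemma eigen_third:
  assumes "eigen p q r s a l" "eigen p q r s b m" "a \<noteq> b" "eigen p q r s x k" "r \<noteq> 0"
  shows "x = a \<or> x = b"
proof -
  have "of_int r * ((x - a) * (x - b)) = 0"
    using eigen_quadratic[OF assms(4)] eigen_vieta[OF assms(1-3)] by algebra
  then show ?thesis using assms(5) by simp
qed

text \<open>At a fixed point with eigenvalue m the derivative of the action is 1 / m^2, so the
  eigenvalue of larger absolute value belongs to the attracting point.\<close>

lemma hyperbolic_fixed_points:
  assumes "A \<in> SL2Z" "hyperbolic A"
    and e: "entries_eigen A a l" "entries_eigen A b (1 / l)" "\<bar>l\<bar> > 1"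
  shows "fixes_point A x \<longleftrightarrow> x = a \<or> x = b" "attracting_point A = a" "repelling_point A = b"
proof -
  have det: "A $ 1 $ 1 * A $ 2 $ 2 - A $ 1 $ 2 * A $ 2 $ 1 = 1" using assms(1) by (simp add: SL2Z_det)
  have r: "A $ 2 $ 1 \<noteq> 0" using hyperbolic_eigen_exists(1)[OF det] assms(2) by (simp add: hyperbolic_trace)
  have ab: "a \<noteq> b" using eigen_distinct e by blast
  have l: "l \<noteq> 0" using e by auto
  show fp: "fixes_point A x \<longleftrightarrow> x = a \<or> x = b" for x
  proof
    show "x = a \<or> x = b" if "fixes_point A x"
      using that eigen_third[OF e(1,2) ab _ r] unfolding fixes_point_iff_eigen by blast
    have "1 / l \<noteq> 0" using l by simp
    with e l show "fixes_point A x" if "x = a \<or> x = b"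
      using that unfolding fixes_point_iff_eigen by blast
  qed
  have deriv: "deriv (SL2Z_act A) x = 1 / m\<^sup>2" if "entries_eigen A x m" "m \<noteq> 0" for x m :: real
    using has_field_derivative_imoebius[of "A $ 2 $ 1" x "A $ 2 $ 2", OF _ det] that
    by (auto simp: SL2Z_act_def eigen_def intro!: DERIV_imp_deriv)
  have l2: "l\<^sup>2 > 1" using power_strict_mono[OF e(3), of 2] by simp
  have da: "\<bar>deriv (SL2Z_act A) a\<bar> < 1" and db: "\<bar>deriv (SL2Z_act A) b\<bar> > 1"
    using deriv[OF e(1)] deriv[OF e(2)] l l2 by (auto simp: power_divide)
  show "attracting_point A = a"
    unfolding attracting_point_def using fp da db by (intro the_equality) auto
  show "repelling_point A = b"
    unfolding repelling_point_def using fp da db by (intro the_equality) auto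
qed

section \<open>The primitive quadratic form of a hyperbolic matrix\<close>

lemma bqf_roots:
  assumes "bqf_eval (\<alpha>, \<beta>, \<gamma>) (a::real) 1 = 0" "bqf_eval (\<alpha>, \<beta>, \<gamma>) b 1 = 0" "a \<noteq> b"
  shows "of_int \<beta> = - of_int \<alpha> * (a + b)" "of_int \<gamma> = of_int \<alpha> * (a * b)"
proof -
  have q: "of_int \<alpha> * a\<^sup>2 + of_int \<beta> * a + of_int \<gamma> = 0" "of_int \<alpha> * b\<^sup>2 + of_int \<beta> * b + of_int \<gamma> = 0"
    using assms(1,2) by simp_all
  then have "(a - b) * (of_int \<beta> + of_int \<alpha> * (a + b)) = 0" by algebra
  then show 1: "of_int \<beta> = - of_int \<alpha> * (a + b)" using assms(3) by auto
  show "of_int \<gamma> = of_int \<alpha> * (a * b)" using q(1) 1 by algebra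
qed

lemma gcd3_mult_int: "gcd (k * a) (gcd (k * b) (k * c)) = \<bar>k\<bar> * gcd a (gcd b c)" for k a b c :: int
proof -
  have "gcd (k * a) (\<bar>k\<bar> * gcd b c) = gcd (k * a) (k * gcd b c)"
    by (cases "k \<ge> 0") auto
  then show ?thesis
    by (simp only: gcd_mult_distrib_int[symmetric])
qed

lemma primitive_bqf_dvd:
  fixes \<alpha> \<beta> \<gamma> \<alpha>' \<beta>' \<gamma>' :: int
  assumes "bqf_primitive (\<alpha>, \<beta>, \<gamma>)" "\<alpha> * \<beta>' = \<alpha>' * \<beta>" "\<alpha> * \<gamma>' = \<alpha>' * \<gamma>"
  shows "\<alpha> dvd \<alpha>'"
proof -
  have g: "gcd \<alpha> (gcd \<beta> \<gamma>) = 1" using assms(1) by simp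
  have "\<alpha> dvd \<alpha>' * \<alpha>" "\<alpha> dvd \<alpha>' * \<beta>" "\<alpha> dvd \<alpha>' * \<gamma>"
    by (simp_all flip: assms(2,3))
  then have "\<alpha> dvd gcd (\<alpha>' * \<alpha>) (gcd (\<alpha>' * \<beta>) (\<alpha>' * \<gamma>))" by simp
  also have "gcd (\<alpha>' * \<alpha>) (gcd (\<alpha>' * \<beta>) (\<alpha>' * \<gamma>)) = \<bar>\<alpha>'\<bar> * gcd \<alpha> (gcd \<beta> \<gamma>)"
    by (rule gcd3_mult_int)
  finally show ?thesis using g by simp
qed

text \<open>Forms with the same two roots are proportional; primitivity makes the leading
  coefficients divide each other, and only a sign is left, which the last hypothesis fixes.\<close>

lemma primitive_bqf_unique:
  fixes a b :: real
  assumes "bqf_primitive (\<alpha>, \<beta>, \<gamma>)" "bqf_primitive (\<alpha>', \<beta>', \<gamma>')"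
    and "bqf_eval (\<alpha>, \<beta>, \<gamma>) a 1 = 0" "bqf_eval (\<alpha>, \<beta>, \<gamma>) b 1 = 0"
    and "bqf_eval (\<alpha>', \<beta>', \<gamma>') a 1 = 0" "bqf_eval (\<alpha>', \<beta>', \<gamma>') b 1 = 0"
    and "a \<noteq> b" "sgn (real_of_int \<alpha>) = sgn (real_of_int \<alpha>')"
  shows "(\<alpha>, \<beta>, \<gamma>) = (\<alpha>', \<beta>', \<gamma>')"
proof -
  note 1 = bqf_roots[OF assms(3,4,7)] and 2 = bqf_roots[OF assms(5,6,7)]
  have "of_int \<alpha> * of_int \<beta>' = (of_int \<alpha>' * of_int \<beta> :: real)" "of_int \<alpha> * of_int \<gamma>' = (of_int \<alpha>' * of_int \<gamma> :: real)"
    unfolding 1 2 by (simp_all only: mult_ac mult_minus_left mult_minus_right)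
  then have eq: "\<alpha> * \<beta>' = \<alpha>' * \<beta>" "\<alpha> * \<gamma>' = \<alpha>' * \<gamma>"
    by (simp_all only: of_int_mult[symmetric] of_int_eq_iff)
  have "\<alpha> dvd \<alpha>'" using primitive_bqf_dvd[OF assms(1) eq] .
  moreover have "\<alpha>' dvd \<alpha>" using primitive_bqf_dvd[OF assms(2) eq[symmetric]] .
  ultimately have abs: "\<bar>\<alpha>\<bar> = \<bar>\<alpha>'\<bar>" by (rule zdvd_antisym_abs)
  have sgn: "sgn \<alpha> = sgn \<alpha>'"
  proof -
    have "real_of_int (sgn c) = sgn (real_of_int c)" for c
      by (simp add: sgn_if)
    with assms(8) have "real_of_int (sgn \<alpha>) = real_of_int (sgn \<alpha>')"
      by (simp only:)
    then show ?thesis by (simp only: of_int_eq_iff)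
  qed
  have "\<alpha> = sgn \<alpha> * \<bar>\<alpha>\<bar>" by (simp only: sgn_mult_abs)
  also have "\<dots> = \<alpha>'" unfolding sgn abs by (simp only: sgn_mult_abs)
  finally have \<alpha>: "\<alpha> = \<alpha>'" .
  have "real_of_int \<beta> = of_int \<beta>'" "real_of_int \<gamma> = of_int \<gamma>'"
    unfolding 1 2 \<alpha> by (rule refl)+
  with \<alpha> show ?thesis by simp
qed

text \<open>The fixed-point equation r x^2 + (s - p) x - q = 0, divided by its content and given the
  prescribed sign, witnesses the definite description. Its discriminant is trace^2 - 4 divided by
  the square of the content, hence positive.\<close>

lemma assoc_form_spec:
  assumes "A \<in> SL2Z" "hyperbolic A"
    and e: "entries_eigen A a l" "entries_eigen A b (1 / l)" "\<bar>l\<bar> > 1"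
  obtains \<alpha> \<beta> \<gamma> where "assoc_form A = (\<alpha>, \<beta>, \<gamma>)"
    "bqf_eval (\<alpha>, \<beta>, \<gamma>) a 1 = 0" "bqf_eval (\<alpha>, \<beta>, \<gamma>) b 1 = 0"
    "sgn (real_of_int \<alpha>) = sgn (b - a)"
proof -
  define p q r s where "p = A $ 1 $ 1" and "q = A $ 1 $ 2" and "r = A $ 2 $ 1" and "s = A $ 2 $ 2"
  have det: "p * s - q * r = 1" using assms(1) by (simp add: SL2Z_det p_def q_def r_def s_def)
  have tr: "\<bar>p + s\<bar> > 2" using assms(2) by (simp add: hyperbolic_trace p_def s_def)
  have E: "eigen p q r s a l" "eigen p q r s b (1 / l)" using e by (simp_all add: p_def q_def r_def s_def)
  have r: "r \<noteq> 0" using hyperbolic_eigen_exists(1)[OF det tr] .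
  have ab: "a \<noteq> b" using eigen_distinct E e(3) by blast
  define P where "P Q \<longleftrightarrow> bqf_primitive Q \<and> bqf_indefinite Q \<and> bqf_eval Q b 1 = 0 \<and> bqf_eval Q a 1 = 0 \<and>
      sgn (real_of_int (fst Q)) = sgn (b - a)" for Q
  have "\<exists>!Q. P Q"
  proof (rule ex_ex1I)
    define g where "g = gcd r (gcd (s - p) (- q))"
    have g: "g > 0" using r by (simp add: g_def)
    define \<sigma> :: int where "\<sigma> = (if sgn (real_of_int r) = sgn (b - a) then 1 else - 1)"
    have \<sigma>: "\<sigma> * \<sigma> = 1" "\<bar>\<sigma>\<bar> = 1" by (auto simp: \<sigma>_def)
    define \<alpha> where "\<alpha> = \<sigma> * (r div g)"
    define \<beta> where "\<beta> = \<sigma> * ((s - p) div g)"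
    define \<gamma> where "\<gamma> = \<sigma> * ((- q) div g)"
    have gd: "g dvd r" "g dvd s - p" "g dvd - q"
      unfolding g_def
      by (rule gcd_dvd1, rule dvd_trans[OF gcd_dvd2 gcd_dvd1], rule dvd_trans[OF gcd_dvd2 gcd_dvd2])
    have c: "g * \<alpha> = \<sigma> * r" "g * \<beta> = \<sigma> * (s - p)" "g * \<gamma> = \<sigma> * (- q)"
      unfolding \<alpha>_def \<beta>_def \<gamma>_def using gd by (metis dvd_mult_div_cancel mult.left_commute)+
    have "g * gcd \<alpha> (gcd \<beta> \<gamma>) = gcd (g * \<alpha>) (gcd (g * \<beta>) (g * \<gamma>))"
      using g by (simp only: gcd3_mult_int abs_of_pos)
    also have "\<dots> = \<bar>\<sigma>\<bar> * g"
      unfolding c unfolding g_def by (rule gcd3_mult_int)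
    finally have prim: "gcd \<alpha> (gcd \<beta> \<gamma>) = 1" using g \<sigma> by simp
    have "g\<^sup>2 * (\<beta>\<^sup>2 - 4 * \<alpha> * \<gamma>) = (g * \<beta>)\<^sup>2 - 4 * (g * \<alpha>) * (g * \<gamma>)"
      by (simp add: power2_eq_square algebra_simps)
    also have "\<dots> = (\<sigma> * \<sigma>) * ((s - p)\<^sup>2 + 4 * r * q)"
      unfolding c by (simp add: power2_eq_square algebra_simps)
    also have "\<dots> = (p + s)\<^sup>2 - 4"
      using det \<sigma>(1) by (simp add: power2_eq_square algebra_simps)
    finally have D: "g\<^sup>2 * (\<beta>\<^sup>2 - 4 * \<alpha> * \<gamma>) = (p + s)\<^sup>2 - 4" .
    have "\<bar>p + s\<bar>\<^sup>2 > 2\<^sup>2" using tr by (intro power_strict_mono) auto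
    then have "g\<^sup>2 * (\<beta>\<^sup>2 - 4 * \<alpha> * \<gamma>) > 0" unfolding D by simp
    then have indef: "\<beta>\<^sup>2 - 4 * \<alpha> * \<gamma> > 0" using g by (simp add: zero_less_mult_iff)
    have root: "bqf_eval (\<alpha>, \<beta>, \<gamma>) x 1 = 0" if "eigen p q r s x m" for x m :: real
    proof -
      have cr: "of_int g * of_int \<alpha> = (of_int \<sigma> * of_int r :: real)"
        "of_int g * of_int \<beta> = (of_int \<sigma> * of_int (s - p) :: real)"
        "of_int g * of_int \<gamma> = (of_int \<sigma> * of_int (- q) :: real)"
        using c by (metis of_int_mult)+
      have "of_int g * bqf_eval (\<alpha>, \<beta>, \<gamma>) x 1
          = (of_int g * of_int \<alpha>) * x\<^sup>2 + (of_int g * of_int \<beta>) * x + of_int g * of_int \<gamma>"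
        by (simp add: algebra_simps)
      also have "\<dots> = of_int \<sigma> * (of_int r * x\<^sup>2 + of_int (s - p) * x - of_int q)"
        unfolding cr by (simp add: algebra_simps)
      also have "\<dots> = 0" using eigen_quadratic[OF that] by simp
      finally show ?thesis using g by simp
    qed
    have "sgn (real_of_int r) \<noteq> 0" "sgn (b - a) \<noteq> 0" using r ab by (auto simp: sgn_if)
    then have "sgn (real_of_int (\<sigma> * r)) = sgn (b - a)"
      by (auto simp: \<sigma>_def sgn_if split: if_splits)
    then have "sgn (real_of_int (g * \<alpha>)) = sgn (b - a)" unfolding c .
    then have "sgn (real_of_int \<alpha>) = sgn (b - a)" using g by (simp add: sgn_mult)
    then show "\<exists>Q. P Q"
      using prim indef root[OF E(1)] root[OF E(2)]
      by (intro exI[of _ "(\<alpha>, \<beta>, \<gamma>)"]) (auto simp: P_def bqf_indefinite_def)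
  next
    show "Q = Q'" if "P Q" "P Q'" for Q Q'
    proof -
      obtain \<alpha> \<beta> \<gamma> where Q: "Q = (\<alpha>, \<beta>, \<gamma>)" by (cases Q)
      obtain \<alpha>' \<beta>' \<gamma>' where Q': "Q' = (\<alpha>', \<beta>', \<gamma>')" by (cases Q')
      show ?thesis
        unfolding Q Q' by (rule primitive_bqf_unique[of _ _ _ _ _ _ a b])
          (use that ab in \<open>simp_all only: P_def Q Q' fst_conv not_False_eq_True\<close>)
    qed
  qed
  then have "P (THE Q. P Q)" by (rule theI')
  moreover have "assoc_form A = (THE Q. P Q)"
    unfolding assoc_form_def P_def hyperbolic_fixed_points[OF assms] ..
  ultimately have "P (assoc_form A)" by simp
  then show thesis
    using that by (cases "assoc_form A") (auto simp: P_def)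
qed

text \<open>The sign convention for the leading coefficient is what yields sqrt D = \<alpha> (b - a)
  without an absolute value; the rest is partial fractions.\<close>

lemma assoc_form_integrand:
  fixes \<tau> :: complex
  assumes "bqf_eval (\<alpha>, \<beta>, \<gamma>) a 1 = 0" "bqf_eval (\<alpha>, \<beta>, \<gamma>) b 1 = 0" "a \<noteq> b"
    "sgn (real_of_int \<alpha>) = sgn (b - a)" "Im \<tau> > 0"
  shows "of_real (sqrt (of_int (bqf_discr (\<alpha>, \<beta>, \<gamma>)))) / bqf_eval (\<alpha>, \<beta>, \<gamma>) \<tau> 1 = geodesic_form a b \<tau>"
proof -
  note roots = bqf_roots[OF assms(1-3)]
  have \<alpha>: "\<alpha> \<noteq> 0" using assms(3,4) by (auto simp: sgn_if split: if_splits)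
  have "real_of_int (bqf_discr (\<alpha>, \<beta>, \<gamma>)) = (of_int \<beta>)\<^sup>2 - 4 * of_int \<alpha> * of_int \<gamma>" by simp
  also have "\<dots> = (of_int \<alpha> * (b - a))\<^sup>2"
    unfolding roots by (simp add: power2_eq_square algebra_simps)
  finally have "sqrt (of_int (bqf_discr (\<alpha>, \<beta>, \<gamma>))) = \<bar>of_int \<alpha> * (b - a)\<bar>"
    by (simp del: bqf_discr.simps)
  also have "\<dots> = of_int \<alpha> * (b - a)"
  proof -
    have "of_int \<alpha> * (b - a) = sgn (real_of_int \<alpha>) * \<bar>of_int \<alpha>\<bar> * (sgn (b - a) * \<bar>b - a\<bar>)"
      by (simp only: sgn_mult_abs)
    also have "\<dots> = (sgn (b - a) * sgn (b - a)) * (\<bar>of_int \<alpha>\<bar> * \<bar>b - a\<bar>)"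
      unfolding assms(4) by (simp only: mult_ac)
    also have "\<dots> \<ge> 0"
      by (intro mult_nonneg_nonneg zero_le_square abs_ge_zero)
    finally show ?thesis by (rule abs_of_nonneg)
  qed
  finally have 1: "sqrt (of_int (bqf_discr (\<alpha>, \<beta>, \<gamma>))) = of_int \<alpha> * (b - a)" .
  have \<beta>: "of_int \<beta> = (- of_int \<alpha> * (of_real a + of_real b) :: complex)"
    and \<gamma>: "of_int \<gamma> = (of_int \<alpha> * (of_real a * of_real b) :: complex)"
    using arg_cong[OF roots(1), of complex_of_real] arg_cong[OF roots(2), of complex_of_real] by simp_all
  have 2: "bqf_eval (\<alpha>, \<beta>, \<gamma>) \<tau> 1 = of_int \<alpha> * ((\<tau> - of_real a) * (\<tau> - of_real b))"
    by (simp add: \<beta> \<gamma> power2_eq_square algebra_simps)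
  have "\<tau> - of_real a \<noteq> 0" "\<tau> - of_real b \<noteq> 0" using assms(5) by (auto simp: complex_eq_iff)
  then show ?thesis
    unfolding 1 2 geodesic_form_def using \<alpha> by (simp add: divide_simps)
qed

definition base_point :: complex where
  "base_point = (SOME \<tau>. \<tau> \<in> upper_half_plane)"

lemma base_point: "base_point \<in> upper_half_plane"
  unfolding base_point_def by (rule someI[of _ \<i>]) simp

lemma cycle_integral_eq:
  assumes "A \<in> SL2Z" "hyperbolic A"
    and e: "entries_eigen A a l" "entries_eigen A b (1 / l)" "\<bar>l\<bar> > 1"
  shows "cycle_integral f A = contour_integral
    (linepath base_point (imoebius (A $ 1 $ 1) (A $ 1 $ 2) (A $ 2 $ 1) (A $ 2 $ 2) base_point))
    (\<lambda>\<tau>. f \<tau> * geodesic_form a b \<tau>)"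
proof -
  obtain \<alpha> \<beta> \<gamma> where Q: "assoc_form A = (\<alpha>, \<beta>, \<gamma>)"
    "bqf_eval (\<alpha>, \<beta>, \<gamma>) a 1 = 0" "bqf_eval (\<alpha>, \<beta>, \<gamma>) b 1 = 0" "sgn (real_of_int \<alpha>) = sgn (b - a)"
    using assoc_form_spec[OF assms] .
  have ab: "a \<noteq> b" using eigen_distinct e by blast
  let ?M = "imoebius (A $ 1 $ 1) (A $ 1 $ 2) (A $ 2 $ 1) (A $ 2 $ 2) base_point"
  have "?M \<in> upper_half_plane"
    using imoebius_upper_half_plane[OF base_point] assms(1) by (simp add: SL2Z_det)
  then have seg: "closed_segment base_point ?M \<subseteq> upper_half_plane"
    using closed_segment_subset[OF base_point _ convex_upper_half_plane] by blast
  have "cycle_integral f A = contour_integral (linepath base_point ?M)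
     (\<lambda>\<tau>. f \<tau> * of_real (sqrt (of_int (bqf_discr (\<alpha>, \<beta>, \<gamma>)))) / bqf_eval (\<alpha>, \<beta>, \<gamma>) \<tau> 1)"
    unfolding cycle_integral_def Q(1) base_point_def[symmetric] SL2Z_act_def Let_def ..
  also have "\<dots> = contour_integral (linepath base_point ?M) (\<lambda>\<tau>. f \<tau> * geodesic_form a b \<tau>)"
  proof (rule contour_integral_eq)
    fix \<tau> assume "\<tau> \<in> path_image (linepath base_point ?M)"
    then have "Im \<tau> > 0" using seg by auto
    from assoc_form_integrand[OF Q(2,3) ab Q(4) this]
    show "f \<tau> * of_real (sqrt (of_int (bqf_discr (\<alpha>, \<beta>, \<gamma>)))) / bqf_eval (\<alpha>, \<beta>, \<gamma>) \<tau> 1 = f \<tau> * geodesic_form a b \<tau>"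
      by (simp only: times_divide_eq_right[symmetric])
  qed
  finally show ?thesis .
qed

section \<open>The golden ratio is minimal\<close>

text \<open>\<open>modular_val\<close> picks its matrix by \<open>SOME\<close>, so existence must be
  secured before anything is known about the chosen one.\<close>

lemma exists_hyperbolic_fixing:
  assumes "real_quadratic_irrationality w"
  shows "\<exists>A. A \<in> SL2Z \<and> hyperbolic A \<and> fixes_point A w"
proof -
  obtain a b c :: int where a: "a \<noteq> 0" and eq: "of_int a * w\<^sup>2 + of_int b * w + of_int c = 0" and w: "w \<notin> \<rat>"
    using assms by (auto simp: real_quadratic_irrationality_def)
  define D where "D = b\<^sup>2 - 4 * a * c"
  have "(2 * of_int a * w + of_int b)\<^sup>2 = real_of_int D"
  proof -
    have "(2 * of_int a * w + of_int b)\<^sup>2 - real_of_int D = 4 * of_int a * (of_int a * w\<^sup>2 + of_int b * w + of_int c)"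
      by (simp add: D_def power2_eq_square algebra_simps)
    then show ?thesis using eq by simp
  qed
  then have sq: "sqrt (real_of_int D) = \<bar>2 * of_int a * w + of_int b\<bar>" and "real_of_int D \<ge> 0"
    by (metis real_sqrt_abs, metis zero_le_power2)
  then have D: "D \<ge> 0" by simp
  have "sqrt (real_of_int D) \<notin> \<rat>"
  proof
    assume "sqrt (real_of_int D) \<in> \<rat>"
    then have "2 * of_int a * w + of_int b \<in> \<rat>" unfolding sq by (simp add: Rats_abs_iff)
    then have "(2 * of_int a * w + of_int b - of_int b) / (2 * of_int a) \<in> \<rat>"
      by (intro Rats_divide Rats_diff Rats_mult) auto
    then show False using a w by simp
  qed
  from pell_solution_exists[OF D this] obtain t u where tu: "t\<^sup>2 - D * u\<^sup>2 = 1" "t > 1" by blast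
  have u: "u \<noteq> 0" 
  proof
    assume "u = 0"
    then have "t\<^sup>2 = 1" using tu(1) by simp
    then show False using tu(2) by (simp add: power2_eq_1_iff)
  qed
  \<comment> \<open>The automorph of the form (a, b, c) given by the Pell solution: its determinant
    is t^2 - D u^2 and its trace is 2 t.\<close>
  define A :: "int ^ 2 ^ 2" where
    "A = vector [vector [t - b * u, - 2 * c * u], vector [2 * a * u, t + b * u]]"
  have A: "A $ 1 $ 1 = t - b * u" "A $ 1 $ 2 = - 2 * c * u" "A $ 2 $ 1 = 2 * a * u" "A $ 2 $ 2 = t + b * u"
    by (simp_all add: A_def vector_2)
  have "A \<in> SL2Z"
    unfolding SL2Z_det A using tu(1) by (simp add: D_def power2_eq_square algebra_simps)
  moreover have "hyperbolic A"
    unfolding hyperbolic_trace A using tu(2) by simp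
  moreover have "fixes_point A w"
  proof -
    let ?l = "of_int (2 * a * u) * w + of_int (t + b * u)"
    have "?l \<noteq> 0"
    proof
      assume "?l = 0"
      then have "w = - of_int (t + b * u) / of_int (2 * a * u)"
        using a u by (simp add: field_simps)
      moreover have "- of_int (t + b * u) / of_int (2 * a * u) \<in> (\<rat> :: real set)"
        by (intro Rats_divide Rats_minus_iff[THEN iffD2] Rats_of_int)
      ultimately show False using w by simp
    qed
    moreover have "of_int (t - b * u) * w + of_int (- 2 * c * u) = ?l * w"
    proof -
      have "?l * w - (of_int (t - b * u) * w + of_int (- 2 * c * u))
          = 2 * of_int u * (of_int a * w\<^sup>2 + of_int b * w + of_int c)"
        by (simp add: power2_eq_square algebra_simps)
      then show ?thesis using eq by simp
    qed
    ultimately have "?l \<noteq> 0 \<and> entries_eigen A w ?l" unfolding A eigen_def by simp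
    then show ?thesis unfolding fixes_point_iff_eigen by blast
  qed
  ultimately show ?thesis by blast
qed

text \<open>The exponential of the primitive is (z - b) / (z - a), which the matrix multiplies by
  l^2. This gives the integral up to a multiple of 2 pi i, and the multiple is 0 because all four
  logarithms have imaginary part strictly between 0 and pi.\<close>

lemma geodesic_form_integral:
  assumes det: "p * s - q * r = 1" and e: "eigen p q r s a l" "eigen p q r s b (1 / l)" "\<bar>l\<bar> > 1"
    and z: "z \<in> upper_half_plane"
  shows "contour_integral (linepath z (imoebius p q r s z)) (geodesic_form a b) = of_real (ln (l\<^sup>2))"
proof -
  define L where "L \<tau> = Ln (\<tau> - of_real b) - Ln (\<tau> - of_real a)" for \<tau> :: complex
  define z' where "z' = imoebius p q r s z"
  have z': "z' \<in> upper_half_plane" unfolding z'_def using imoebius_upper_half_plane[OF z det] .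
  have nonpos: "\<tau> - of_real c \<notin> \<real>\<^sub>\<le>\<^sub>0" if "\<tau> \<in> upper_half_plane" for \<tau> :: complex and c :: real
    using that by (auto simp: complex_nonpos_Reals_iff)
  have "(L has_field_derivative geodesic_form a b \<tau>) (at \<tau> within upper_half_plane)"
    if "\<tau> \<in> upper_half_plane" for \<tau>
    unfolding L_def geodesic_form_def using nonpos[OF that]
    by (auto intro!: derivative_eq_intros simp: divide_inverse)
  from contour_integral_primitive[OF this, of "linepath z z'"]
  have int: "contour_integral (linepath z z') (geodesic_form a b) = L z' - L z"
    using closed_segment_subset[OF z z' convex_upper_half_plane]
    by (intro contour_integral_unique) simp
  have nz: "\<tau> - of_real c \<noteq> 0" if "\<tau> \<in> upper_half_plane" for \<tau> :: complex and c :: real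
    using that by auto
  have expL: "exp (L \<tau>) = (\<tau> - of_real b) / (\<tau> - of_real a)" if "\<tau> \<in> upper_half_plane" for \<tau>
    using nz[OF that] by (simp add: L_def exp_diff)
  have l: "l \<noteq> 0" using e(3) by auto
  then have l': "1 / l \<noteq> 0" by simp
  define d where "d = of_int r * z + of_int s"
  have d: "d \<noteq> 0" unfolding d_def using moebius_denom_nonzero[OF z det] .
  have diff: "z' - of_real x = (z - of_real x) / (d * of_real m)" if "eigen p q r s x m" "m \<noteq> 0" for x m :: real
  proof -
    have E: "of_int p * of_real x + of_int q = (of_real m * of_real x :: complex)"
      "of_int r * of_real x + of_int s = (of_real m :: complex)"
      using that(1) unfolding eigen_def
      by (metis of_real_add of_real_mult of_real_of_int_eq)+
    have det': "of_int p * of_int s - of_int q * of_int r = (1 :: complex)"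
      using det by (metis of_int_1 of_int_diff of_int_mult)
    have "of_real m * (of_int p * z + of_int q - of_real x * d) = z - of_real x"
      using E det' unfolding d_def by algebra
    moreover have "z' - of_real x = (of_int p * z + of_int q - of_real x * d) / d"
    proof -
      have "z' = (of_int p * z + of_int q) / d" by (simp add: z'_def moebius_def d_def)
      then show ?thesis using d by (simp add: field_simps)
    qed
    ultimately have "of_real m * (d * (z' - of_real x)) = z - of_real x" using d by simp
    then show ?thesis using that(2) d by (simp add: field_simps)
  qed
  have "exp (L z' - L z) = ((z' - of_real b) / (z' - of_real a)) / ((z - of_real b) / (z - of_real a))"
    by (simp add: exp_diff expL[OF z] expL[OF z'])
  also have "\<dots> = of_real (l\<^sup>2)"
  proof -
    have "(v / (d * (1 / m)) / (u / (d * m))) / (v / u) = m\<^sup>2" if "u \<noteq> 0" "v \<noteq> 0" "m \<noteq> 0" for u v m :: complex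
      using that d by (simp add: power2_eq_square)
    from this[of "z - of_real a" "z - of_real b" "of_real l"] show ?thesis
      unfolding diff[OF e(1) l] diff[OF e(2) l'] using nz[OF z] l by simp
  qed
  also have "\<dots> = exp (of_real (ln (l\<^sup>2)))"
    using l by (simp add: exp_of_real)
  finally obtain n :: int where n: "L z' - L z = of_real (ln (l\<^sup>2)) + (of_int (2 * n) * pi) * \<i>"
    by (auto simp: exp_eq)
  have arg: "0 < Im (Ln (\<tau> - of_real c)) \<and> Im (Ln (\<tau> - of_real c)) < pi" if "\<tau> \<in> upper_half_plane" for \<tau> :: complex and c :: real
    using Im_Ln_pos_lt[OF nz[OF that]] that by simp
  have "\<bar>Im (L z' - L z)\<bar> < 2 * pi"
    unfolding L_def minus_complex.simps
    using arg[OF z, of a] arg[OF z, of b] arg[OF z', of a] arg[OF z', of b] by linarith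
  then have "\<bar>2 * of_int n * pi\<bar> < 2 * pi" unfolding n by simp
  then have "\<bar>real_of_int n\<bar> < 1" using pi_gt_zero by (simp add: abs_mult)
  then have "n = 0" by linarith
  with n int show ?thesis by (simp add: z'_def)
qed

interpretation one: modular_real_on_arc "\<lambda>_. 1"
  by unfold_locales auto

lemma weakly_holomorphic_imp_modular_invariant:
  assumes "weakly_holomorphic_modular_function f"
  shows "modular_invariant f"
proof
  show "f holomorphic_on upper_half_plane"
    using assms by (simp add: weakly_holomorphic_modular_function_def)
  fix p q r s :: int and z :: complex
  assume det: "p * s - q * r = 1" and z: "z \<in> upper_half_plane"
  define A :: "int ^ 2 ^ 2" where "A = vector [vector [p, q], vector [r, s]]"
  have "A \<in> SL2Z" using det by (simp add: SL2Z_det A_def)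
  then have "f (SL2Z_act A z) = f z"
    using assms z by (simp add: weakly_holomorphic_modular_function_def)
  then show "f (imoebius p q r s z) = f z"
    by (simp add: SL2Z_act_def A_def)
qed

lemma hyperbolic_cycle_integrals:
  fixes h x k y :: int
  assumes "A \<in> SL2Z" "hyperbolic A"
    and e: "entries_eigen A a l" "entries_eigen A b (1 / l)" "\<bar>l\<bar> > 1"
    and det': "h * y - x * k = 1"
    and pos: "(of_int y * a - of_int x) / (of_int h - of_int k * a) > 0" (is "?a > 0")
    and neg: "(of_int y * b - of_int x) / (of_int h - of_int k * b) < 0" (is "?b < 0")
  shows "\<exists>bs. word_act bs ?a = ?a \<and> back_act bs (- ?b) = - ?b \<and>
    (\<forall>f. modular_invariant f \<longrightarrow>
      cycle_integral f A = (\<Sum>(u, v)\<leftarrow>orbit bs ?a (- ?b). modular_invariant.arc_term f u v))"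
proof -
  have det: "A $ 1 $ 1 * A $ 2 $ 2 - A $ 1 $ 2 * A $ 2 $ 1 = 1" using assms(1) by (simp add: SL2Z_det)
  from hyperbolic_word[OF det e det' pos neg] obtain bs where bs: "word_act bs ?a = ?a" "back_act bs (- ?b) = - ?b"
    "\<forall>f z. modular_invariant f \<longrightarrow> z \<in> upper_half_plane \<longrightarrow>
      modular_invariant.geodesic_integral f a b z (imoebius (A $ 1 $ 1) (A $ 1 $ 2) (A $ 2 $ 1) (A $ 2 $ 2) z)
      = (\<Sum>(u, v)\<leftarrow>orbit bs ?a (- ?b). modular_invariant.arc_term f u v)" by blast
  have "cycle_integral f A = (\<Sum>(u, v)\<leftarrow>orbit bs ?a (- ?b). modular_invariant.arc_term f u v)"
    if "modular_invariant f" for f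
    using bs(3)[rule_format, OF that base_point] unfolding modular_invariant.geodesic_integral_def[OF that]
      cycle_integral_eq[OF assms(1,2) e] .
  with bs(1,2) show ?thesis by blast
qed

lemma cycle_integral_one:
  assumes "A \<in> SL2Z" "hyperbolic A"
    and e: "entries_eigen A a l" "entries_eigen A b (1 / l)" "\<bar>l\<bar> > 1"
  shows "cycle_integral (\<lambda>_. 1) A = of_real (ln (l\<^sup>2))" "ln (l\<^sup>2) > 0"
proof -
  have det: "A $ 1 $ 1 * A $ 2 $ 2 - A $ 1 $ 2 * A $ 2 $ 1 = 1" using assms(1) by (simp add: SL2Z_det)
  show "cycle_integral (\<lambda>_. 1) A = of_real (ln (l\<^sup>2))"
    unfolding cycle_integral_eq[OF assms] mult_1 by (rule geodesic_form_integral[OF det e base_point])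
  have "l\<^sup>2 > 1" using power_strict_mono[OF e(3), of 2] by simp
  then show "ln (l\<^sup>2) > 0" by (rule ln_gt_zero)
qed

section \<open>The golden ratio and its orbit\<close>

definition golden :: real where "golden = (1 + sqrt 5) / 2"

lemma golden_square: "golden\<^sup>2 = golden + 1"
  by (simp add: golden_def power2_eq_square field_simps)

lemma golden_gt_1: "golden > 1"
proof -
  have "sqrt 5 > 1" by (rule real_less_rsqrt) simp
  then show ?thesis by (simp add: golden_def)
qed

lemma golden_inverse: "1 / golden = golden - 1" "1 / (golden - 1) = golden"
  using golden_square golden_gt_1 by (simp_all add: field_simps power2_eq_square)

lemma golden_irrational: "golden \<notin> \<rat>"
proof
  assume "golden \<in> \<rat>"
  then obtain a b where ab: "golden = of_int a / of_int b" "b > 0" "coprime a b"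
    by (meson Rats_cases')
  have "(of_int a / of_int b)\<^sup>2 = of_int a / of_int b + (1::real)"
    using golden_square unfolding ab(1) .
  then have "real_of_int (a\<^sup>2) = of_int (a * b + b\<^sup>2)"
    using ab(2) by (simp add: field_simps power2_eq_square)
  then have eq: "a\<^sup>2 = a * b + b\<^sup>2" by (simp only: of_int_eq_iff)
  then have "a\<^sup>2 = b * (a + b)" by (simp add: power2_eq_square algebra_simps)
  then have "b dvd a\<^sup>2" by simp
  moreover have "coprime b (a\<^sup>2)" using ab(3) by (simp add: coprime_commute)
  ultimately have "is_unit b" by (metis coprime_absorb_left)
  then have "b = 1" using ab(2) by simp
  then have "a * (a - 1) = 1" using eq by (simp add: power2_eq_square algebra_simps)
  then show False by (auto simp: zmult_eq_1_iff)
qed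

lemma inv_sum_golden: "inv_sum golden = sqrt 5" "inv_sum (1 / golden) = sqrt 5"
proof -
  show "inv_sum golden = sqrt 5"
    unfolding inv_sum_def golden_inverse by (simp add: golden_def field_simps)
  then show "inv_sum (1 / golden) = sqrt 5" by simp
qed

text \<open>Each of phi and 1 / phi has only the other as a positive predecessor, through a single
  letter. A word fixing phi therefore alternates between the two letters.\<close>

lemma farey_golden:
  assumes "v > 0"
  shows "farey b v = golden \<Longrightarrow> v = 1 / golden \<and> b"
    and "farey b v = 1 / golden \<Longrightarrow> v = golden \<and> \<not> b"
proof -
  have V: "v / (v + 1) < 1" using assms by simp
  show "v = 1 / golden \<and> b" if "farey b v = golden"
  proof (cases b)
    case True
    then show ?thesis using that golden_inverse by (simp add: farey_def)
  next
    case False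
    then show ?thesis using that V golden_gt_1 by (simp add: farey_def)
  qed
  show "v = golden \<and> \<not> b" if "farey b v = 1 / golden"
  proof (cases b)
    case True
    then have "v + 1 = 1 / golden" using that by (simp add: farey_def)
    moreover have "1 / golden < 1" using golden_gt_1 by simp
    ultimately show ?thesis using assms by simp
  next
    case False
    then have "v / (v + 1) = 1 / golden" using that by (simp add: farey_def)
    then have "v * golden = v + 1" using assms golden_gt_1 by (simp add: field_simps)
    then have "v * (golden - 1) = 1" by (simp add: algebra_simps)
    then have "v = 1 / (golden - 1)" using golden_gt_1 by (simp add: field_simps)
    then show ?thesis using False golden_inverse(2) by simp
  qed
qed

lemma farey_golden_back: "farey True (1 / golden) = golden" "farey False golden = 1 / golden"
  using golden_gt_1 golden_square golden_inverse(1)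
  by (simp_all add: farey_def) (simp add: field_simps power2_eq_square)

context modular_real_on_arc
begin

text \<open>The induction needs both starting values w, with second component 1 / w. The two
  possible terms are complex conjugates of each other, so \<open>C\<close> makes their imaginary
  parts telescope; for a closed orbit the sum is real.\<close>

lemma golden_orbit:
  assumes "u > 0" "w = golden \<or> w = 1 / golden" "word_act bs u = w"
  defines "C \<equiv> \<lambda>x. if x = golden then Im (arc_term golden (1 / golden)) else 0"
  shows "(\<forall>s\<in>set (orbit_traces (orbit bs u (1 / w))). s = sqrt 5)
     \<and> Im (\<Sum>(x, m)\<leftarrow>orbit bs u (1 / w). arc_term x m) = C w - C u"
  using assms(2,3)
proof (induction bs arbitrary: w)
  case Nil
  then show ?case by simp
next
  case (Cons b bs)
  have v: "word_act bs u > 0" using assms(1) by (rule word_act_pos)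
  have ne: "1 / golden \<noteq> golden" using golden_gt_1 by (simp add: field_simps) (metis less_1_mult less_irrefl)
  have fw: "farey b (word_act bs u) = w" using Cons.prems(2) by simp
  show ?case
  proof (cases "w = golden")
    case True
    with fw farey_golden(1)[OF v] have b: "word_act bs u = 1 / golden" b by auto
    from Cons.IH[OF _ b(1)] have IH: "(\<forall>s\<in>set (orbit_traces (orbit bs u golden)). s = sqrt 5)"
      "Im (\<Sum>(x, m)\<leftarrow>orbit bs u golden. arc_term x m) = C (1 / golden) - C u" by simp_all
    have "orbit (b # bs) u (1 / w) = (golden, 1 / golden) # orbit bs u golden"
      using fw True b farey_golden_back(1) by simp
    then show ?thesis using IH True ne by (simp add: inv_sum_golden C_def)
  next
    case False
    with Cons.prems have w: "w = 1 / golden" by simp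
    with fw farey_golden(2)[OF v] have b: "word_act bs u = golden" "\<not> b" by auto
    from Cons.IH[OF _ b(1)] have IH: "(\<forall>s\<in>set (orbit_traces (orbit bs u (1 / golden))). s = sqrt 5)"
      "Im (\<Sum>(x, m)\<leftarrow>orbit bs u (1 / golden). arc_term x m) = C golden - C u" by simp_all
    have "orbit (b # bs) u (1 / w) = (1 / golden, golden) # orbit bs u (1 / golden)"
      using fw w b farey_golden_back(2) by simp
    moreover have "Im (arc_term (1 / golden) golden) = - Im (arc_term golden (1 / golden))"
      by (simp add: arc_swap[of "1 / golden" golden])
    ultimately show ?thesis using IH w ne by (simp add: inv_sum_golden C_def)
  qed
qed

text \<open>One list \<open>ss\<close> serves f and the constant 1, so the real part of the value at
  w is the mean of f on the arc for the weight given by \<open>ss\<close>.\<close>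

lemma cycle_integral_kernels:
  assumes "A \<in> SL2Z" "hyperbolic A" "fixes_point A w" "w \<notin> \<rat>"
  obtains ss c where "c > 0" "cycle_integral (\<lambda>_. 1) A = of_real c"
    "\<forall>s\<in>set ss. s \<ge> 2" "0 \<le> sum_list (map balance ss)"
    "Re (cycle_integral f A) = integral arc_range (\<lambda>t. Re (f (cis t)) * (\<Sum>s\<leftarrow>ss. arc_kernel s t))"
    "c = integral arc_range (\<lambda>t. \<Sum>s\<leftarrow>ss. arc_kernel s t)"
proof -
  have det: "A $ 1 $ 1 * A $ 2 $ 2 - A $ 1 $ 2 * A $ 2 $ 1 = 1" using assms(1) by (simp add: SL2Z_det)
  have tr: "\<bar>A $ 1 $ 1 + A $ 2 $ 2\<bar> > 2" using assms(2) by (simp add: hyperbolic_trace)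
  obtain a b l where e: "entries_eigen A a l" "entries_eigen A b (1 / l)" "\<bar>l\<bar> > 1"
    using hyperbolic_eigen_exists(2)[OF det tr] by blast
  have r: "A $ 2 $ 1 \<noteq> 0" using hyperbolic_eigen_exists(1)[OF det tr] .
  have ab: "a \<noteq> b" using eigen_distinct e by blast
  have w: "w = a \<or> w = b" using hyperbolic_fixed_points(1)[OF assms(1,2) e] assms(3) by simp
  \<comment> \<open>The sum of the fixed points is rational, so the irrationality of w passes to the
    other one, as the separation lemma demands.\<close>
  have "a + b = - of_int (A $ 2 $ 2 - A $ 1 $ 1) / of_int (A $ 2 $ 1)"
    unfolding eigen_vieta(1)[OF e(1,2) ab] using r by simp
  moreover have "- of_int (A $ 2 $ 2 - A $ 1 $ 1) / of_int (A $ 2 $ 1) \<in> (\<rat> :: real set)"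
    by (intro Rats_divide Rats_minus_iff[THEN iffD2] Rats_of_int)
  ultimately have sum: "a + b \<in> \<rat>" by simp
  have "a \<in> \<rat> \<Longrightarrow> b \<in> \<rat>" "b \<in> \<rat> \<Longrightarrow> a \<in> \<rat>"
    using Rats_diff[OF sum, of a] Rats_diff[OF sum, of b]
    unfolding add_diff_cancel_left' add_diff_cancel_right' by blast+
  with w assms(4) have "a \<notin> \<rat>" "b \<notin> \<rat>" by blast+
  from unimodular_separation[OF ab this] obtain h x k y :: int where
    g: "h * y - x * k = 1" "(of_int y * a - of_int x) / (of_int h - of_int k * a) > 0"
      "(of_int y * b - of_int x) / (of_int h - of_int k * b) < 0" by blast
  define u where "u = (of_int y * a - of_int x) / (of_int h - of_int k * a)"
  define n where "n = - ((of_int y * b - of_int x) / (of_int h - of_int k * b))"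
  have pos: "u > 0" "n > 0" using g(2,3) unfolding u_def n_def by (simp_all only: neg_0_less_iff_less)
  obtain bs where bs: "word_act bs u = u" "back_act bs n = n"
    "\<forall>f. modular_invariant f \<longrightarrow> cycle_integral f A = (\<Sum>(u, v)\<leftarrow>orbit bs u n. modular_invariant.arc_term f u v)"
    using hyperbolic_cycle_integrals[OF assms(1,2) e g, folded u_def n_def] by blast
  define ss where "ss = orbit_traces (orbit bs u n)"
  have opos: "x > 0 \<and> m > 0" if "(x, m) \<in> set (orbit bs u n)" for x m
    using orbit_pos[OF pos that] by blast
  have one: "cycle_integral (\<lambda>_. 1) A = of_real (ln (l\<^sup>2))" "ln (l\<^sup>2) > 0"
    using cycle_integral_one[OF assms(1,2) e] by blast+
  show thesis
  proof (rule that[OF one(2,1)])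
    show "\<forall>s\<in>set ss. s \<ge> 2"
      using orbit_traces_ge_2[OF pos] unfolding ss_def by blast
    \<comment> \<open>Both components return to their starting values, so every boundary term of
      \<open>orbit_balance\<close> cancels.\<close>
    show "0 \<le> sum_list (map balance ss)"
      using orbit_balance[OF pos, of bs] unfolding ss_def bs(1,2) by simp
    show "Re (cycle_integral f A) = integral arc_range (\<lambda>t. Re (f (cis t)) * (\<Sum>s\<leftarrow>ss. arc_kernel s t))"
      unfolding bs(3)[rule_format, OF modular_invariant_axioms] ss_def
      using integral_unique[OF Re_sum_arc_has_integral[of "orbit bs u n", OF opos]] by simp
    have "Re (cycle_integral (\<lambda>_. 1) A) = integral arc_range (\<lambda>t. \<Sum>s\<leftarrow>ss. arc_kernel s t)"
      unfolding bs(3)[rule_format, OF one.modular_invariant_axioms] ss_def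
      using integral_unique[OF one.Re_sum_arc_has_integral[of "orbit bs u n", OF opos]] by simp
    then show "ln (l\<^sup>2) = integral arc_range (\<lambda>t. \<Sum>s\<leftarrow>ss. arc_kernel s t)"
      unfolding one(1) by (simp only: Re_complex_of_real)
  qed
qed

lemma cycle_integral_golden:
  assumes "A \<in> SL2Z" "hyperbolic A" "fixes_point A golden"
  obtains m c where "c > 0" "cycle_integral (\<lambda>_. 1) A = of_real c" "cycle_integral f A \<in> \<real>"
    "Re (cycle_integral f A) = m * integral arc_range (\<lambda>t. Re (f (cis t)) * arc_kernel (sqrt 5) t)"
    "c = m * integral arc_range (arc_kernel (sqrt 5))"
proof -
  define p q r s where "p = A $ 1 $ 1" and "q = A $ 1 $ 2" and "r = A $ 2 $ 1" and "s = A $ 2 $ 2"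
  have det: "p * s - q * r = 1" using assms(1) by (simp add: SL2Z_det p_def q_def r_def s_def)
  have tr: "\<bar>p + s\<bar> > 2" using assms(2) by (simp add: hyperbolic_trace p_def s_def)
  obtain a b l where E: "eigen p q r s a l" "eigen p q r s b (1 / l)" "\<bar>l\<bar> > 1"
    using hyperbolic_eigen_exists(2)[OF det tr] by blast
  then have e: "entries_eigen A a l" "entries_eigen A b (1 / l)" by (simp_all add: p_def q_def r_def s_def)
  have r: "r \<noteq> 0" using hyperbolic_eigen_exists(1)[OF det tr] .
  have ab: "a \<noteq> b" using eigen_distinct E by blast
  have w: "golden = a \<or> golden = b" using hyperbolic_fixed_points(1)[OF assms(1,2) e E(3)] assms(3) by simp
  obtain k where "eigen p q r s golden k"
    using assms(3) unfolding fixes_point_iff_eigen p_def q_def r_def s_def by blast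
  from eigen_quadratic[OF this] have lin: "of_int (r + s - p) * golden = of_int (q - r)"
    unfolding golden_square by (simp add: algebra_simps)
  have rsp: "r + s - p = 0"
  proof (rule ccontr)
    assume "r + s - p \<noteq> 0"
    then have "golden = of_int (q - r) / of_int (r + s - p)"
      using lin by (simp add: field_simps)
    moreover have "of_int (q - r) / of_int (r + s - p) \<in> (\<rat> :: real set)"
      by (intro Rats_divide Rats_of_int)
    ultimately show False using golden_irrational by (simp only:)
  qed
  have "of_int r * (a + b - 1) = 0"
  proof -
    have "of_int (s - p) = (- of_int r :: real)" using rsp by (simp flip: of_int_minus)
    with eigen_vieta(1)[OF E(1,2) ab] show ?thesis by (simp add: algebra_simps)
  qed
  then have sum: "a + b = 1" using r by simp
  \<comment> \<open>The chosen matrix may attract or repel at phi. The identity serves in the first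
    case; in the second, z -> - 1 / z moves the pair (- 1 / phi, phi) to (phi, - 1 / phi).\<close>
  have "\<exists>h x k y :: int. h * y - x * k = 1 \<and> (of_int y * a - of_int x) / (of_int h - of_int k * a) = golden
      \<and> (of_int y * b - of_int x) / (of_int h - of_int k * b) = - (1 / golden)"
  proof (cases "golden = a")
    case True
    then have "b = - (1 / golden)" using sum golden_inverse by simp
    with True show ?thesis by (intro exI[of _ 1] exI[of _ 0]) simp
  next
    case False
    then have b: "b = golden" using w by simp
    then have a: "a = - (1 / golden)" using sum golden_inverse by simp
    show ?thesis
      by (rule exI[of _ 0], rule exI[of _ "- 1"], rule exI[of _ 1], rule exI[of _ 0]) (simp add: a b)
  qed
  then obtain h x k y :: int where g: "h * y - x * k = 1"
    and ga: "(of_int y * a - of_int x) / (of_int h - of_int k * a) = golden"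
    and gb: "(of_int y * b - of_int x) / (of_int h - of_int k * b) = - (1 / golden)" by blast
  have pos: "golden > 0" "1 / golden > 0" using golden_gt_1 by simp_all
  have pos': "(of_int y * a - of_int x) / (of_int h - of_int k * a) > 0"
    "(of_int y * b - of_int x) / (of_int h - of_int k * b) < 0"
    unfolding ga gb using pos by simp_all
  obtain bs where bs: "word_act bs golden = golden"
    "\<forall>f. modular_invariant f \<longrightarrow> cycle_integral f A = (\<Sum>(u, v)\<leftarrow>orbit bs golden (1 / golden). modular_invariant.arc_term f u v)"
    using hyperbolic_cycle_integrals[OF assms(1,2) e E(3) g pos'] unfolding ga gb minus_minus by blast
  define ss where "ss = orbit_traces (orbit bs golden (1 / golden))"
  have ss: "\<forall>s\<in>set ss. s = sqrt 5" and Im0: "Im (\<Sum>(x, m)\<leftarrow>orbit bs golden (1 / golden). arc_term x m) = 0"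
    using golden_orbit[OF pos(1) _ bs(1)] unfolding ss_def by simp_all
  have kernels: "(\<Sum>s\<leftarrow>ss. arc_kernel s t) = real (length ss) * arc_kernel (sqrt 5) t" for t
  proof -
    have "(\<Sum>s\<leftarrow>ss. arc_kernel s t) = (\<Sum>s\<leftarrow>ss. arc_kernel (sqrt 5) t)"
      using ss by (intro arg_cong[where f = sum_list] map_cong) auto
    then show ?thesis by (simp add: sum_list_triv)
  qed
  have opos: "x > 0 \<and> m > 0" if "(x, m) \<in> set (orbit bs golden (1 / golden))" for x m
    using orbit_pos[OF pos that] by blast
  have one: "cycle_integral (\<lambda>_. 1) A = of_real (ln (l\<^sup>2))" "ln (l\<^sup>2) > 0"
    using cycle_integral_one[OF assms(1,2) e E(3)] by blast+
  show thesis
  proof (rule that[OF one(2,1)])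
    show "cycle_integral f A \<in> \<real>"
      unfolding bs(2)[rule_format, OF modular_invariant_axioms] complex_is_Real_iff by (rule Im0)
    have "Re (cycle_integral f A) = integral arc_range (\<lambda>t. real (length ss) * (Re (f (cis t)) * arc_kernel (sqrt 5) t))"
      unfolding bs(2)[rule_format, OF modular_invariant_axioms]
      using integral_unique[OF Re_sum_arc_has_integral[of "orbit bs golden (1 / golden)", OF opos], folded ss_def] unfolding kernels by (simp add: mult.left_commute)
    then show "Re (cycle_integral f A) = real (length ss) * integral arc_range (\<lambda>t. Re (f (cis t)) * arc_kernel (sqrt 5) t)"
      by simp
    have "Re (cycle_integral (\<lambda>_. 1) A) = integral arc_range (\<lambda>t. real (length ss) * arc_kernel (sqrt 5) t)"
      unfolding bs(2)[rule_format, OF one.modular_invariant_axioms]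
      using integral_unique[OF one.Re_sum_arc_has_integral[of "orbit bs golden (1 / golden)", OF opos], folded ss_def] unfolding kernels by simp
    then show "ln (l\<^sup>2) = real (length ss) * integral arc_range (arc_kernel (sqrt 5))"
      unfolding one(1) by (simp only: Re_complex_of_real integral_mult_right)
  qed
qed

end

theorem theorem2p1:
  fixes f :: "complex \<Rightarrow> complex" and w :: real
  assumes "weakly_holomorphic_modular_function f"
    and "\<forall>t\<in>{pi / 3..2 * pi / 3}. f (exp (\<i> * of_real t)) \<in> \<real> \<and> Re (f (exp (\<i> * of_real t))) \<ge> 0"
    and "mono_on {pi / 3..pi / 2} (\<lambda>t. Re (f (exp (\<i> * of_real t))))"
    and "real_quadratic_irrationality w"
  shows "modular_val f ((1 + sqrt 5) / 2) \<in> \<real> \<and>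
         Re (modular_val f w) \<ge> Re (modular_val f ((1 + sqrt 5) / 2))"
proof -
  interpret modular_real_on_arc f
    using weakly_holomorphic_imp_modular_invariant[OF assms(1)] assms(2)
    by (simp add: modular_real_on_arc_def modular_real_on_arc_axioms_def cis_conv_exp)
  define F where "F t = Re (f (cis t))" for t
  have mono: "mono_on {pi / 3..pi / 2} F"
    using assms(3) unfolding F_def cis_conv_exp .
  have cont: "continuous_on arc_range F"
    unfolding F_def by (intro continuous_intros continuous_on_arc)
  have "real_quadratic_irrationality golden"
    unfolding real_quadratic_irrationality_def using golden_irrational golden_square
    by (intro conjI exI[of _ 1] exI[of _ "- 1"]) auto
  note ex = exists_hyperbolic_fixing[OF this] exists_hyperbolic_fixing[OF assms(4)]
  define A where "A = (SOME A. A \<in> SL2Z \<and> hyperbolic A \<and> fixes_point A golden)"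
  define B where "B = (SOME A. A \<in> SL2Z \<and> hyperbolic A \<and> fixes_point A w)"
  have A: "A \<in> SL2Z" "hyperbolic A" "fixes_point A golden"
    using someI_ex[OF ex(1)] unfolding A_def by blast+
  have B: "B \<in> SL2Z" "hyperbolic B" "fixes_point B w"
    using someI_ex[OF ex(2)] unfolding B_def by blast+
  have val: "modular_val f ((1 + sqrt 5) / 2) = cycle_integral f A / cycle_integral (\<lambda>_. 1) A"
    "modular_val f w = cycle_integral f B / cycle_integral (\<lambda>_. 1) B"
    unfolding modular_val_def Let_def A_def B_def golden_def by simp_all
  obtain m c where m: "c > 0" "cycle_integral (\<lambda>_. 1) A = of_real c" "cycle_integral f A \<in> \<real>"
    "Re (cycle_integral f A) = m * integral arc_range (\<lambda>t. F t * arc_kernel (sqrt 5) t)"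
    "c = m * integral arc_range (arc_kernel (sqrt 5))"
    by (rule cycle_integral_golden[OF A, folded F_def])
  have w: "w \<notin> \<rat>" using assms(4) by (simp add: real_quadratic_irrationality_def)
  obtain ss d where ss: "d > 0" "cycle_integral (\<lambda>_. 1) B = of_real d"
    "\<forall>s\<in>set ss. s \<ge> 2" "0 \<le> sum_list (map balance ss)"
    "Re (cycle_integral f B) = integral arc_range (\<lambda>t. F t * (\<Sum>s\<leftarrow>ss. arc_kernel s t))"
    "d = integral arc_range (\<lambda>t. \<Sum>s\<leftarrow>ss. arc_kernel s t)"
    by (rule cycle_integral_kernels[OF B w, folded F_def])
  define P where "P = integral arc_range (\<lambda>t. F t * arc_kernel (sqrt 5) t)"
  define K where "K = integral arc_range (arc_kernel (sqrt 5))"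
  have "K \<ge> 0"
    unfolding K_def using real_le_rsqrt[of 2 5]
    by (intro integral_nonneg integrable_continuous_real continuous_on_arc_kernel less_imp_le[OF arc_kernel_pos]) auto
  with m(1,5) have K: "K > 0" "m \<noteq> 0" unfolding K_def[symmetric] by (auto simp: less_le)
  have "P * d \<le> Re (cycle_integral f B) * K"
    unfolding P_def K_def ss(5,6)
    by (rule arc_mean_minimal[OF cont _ mono ss(3)[rule_format] ss(4)]) (simp_all add: F_def arc_reflect)
  then have "P / K \<le> Re (cycle_integral f B) / d"
    using K ss(1) by (simp add: field_simps)
  \<comment> \<open>The multiplicity m, the only quantity here that depends on the chosen matrix,
    cancels.\<close>
  moreover have "Re (modular_val f ((1 + sqrt 5) / 2)) = P / K"
    unfolding val m(2) Re_divide_of_real m(4,5) P_def[symmetric] K_def[symmetric] using K by simp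
  moreover have "Re (modular_val f w) = Re (cycle_integral f B) / d"
    unfolding val ss(2) by (rule Re_divide_of_real)
  moreover have "modular_val f ((1 + sqrt 5) / 2) \<in> \<real>"
    unfolding val m(2) by (intro Reals_divide m(3) Reals_of_real)
  ultimately show ?thesis by simp
qed

end
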